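(* Let $q$ be a complex number with $0<|q|<1$. (1) Define sequences $(P_m)_{m\ge 0}$, $(Q_m)_{m\ge 0}$ by $$P_m=(1+q+q^{2m-1})P_{m-1}+(q^{2m-2}-q)P_{m-2}\quad(m\ge 2),\qquad P_0=1,\ P_1=1+q,$$ $$Q_m=(1+q+q^{2m-1})Q_{m-1}+(q^{2m-2}-q)Q_{m-2}\quad(m\ge 2),\qquad Q_0=0,\ Q_1=1.$$ Then for every integer $m\ge 1$, $$\sum_{n=0}^{\infty}\frac{(-q;q^2)_nq^{n^2+2mn}}{(q;q)_{2n+1}}=\frac{q^{1-m}(q^2,q^{10},q^{12};q^{12})_{\infty}}{(q;q^2)_{m-1}(q;q)_{\infty}}P_{m-1}-\frac{q^{1-m}(-q^2,-q^4,q^6;q^6)_{\infty}(-q;q^2)_{\infty}}{(q;q^2)_{m-1}(q^2;q^2)_{\infty}}Q_{m-1}.$$ (2) Define sequences $(A_m)_{m\ge 0}$, $(B_m)_{m\ge 0}$ by $$A_m=(1+q+q^{2m-2})A_{m-1}+(q^{2m-2}-q)A_{m-2}\quad(m\ge 2),\qquad A_0=1,\ A_1=1,$$ $$B_m=(1+q+q^{2m-2})B_{m-1}+(q^{2m-2}-q)B_{m-2}\quad(m\ge 2),\qquad B_0=0,\ B_1=2q.$$ Then for every integer $m\ge 0$, $$\sum_{n=0}^{\infty}\frac{(-q;q^2)_nq^{n^2+2mn}}{(q;q)_{2n}}=\frac{(-q^2,-q^4,q^6;q^6)_{\infty}(-q;q^2)_{\infty}}{(q;q^2)_m(q^2;q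^2)_{\infty}}A_m-\frac{(q^2,q^{10},q^{12};q^{12})_{\infty}}{(q;q^2)_m(q;q)_{\infty}}B_m.$$
   Context: For $|p|<1$, $(a;p)_\infty=\prod_{k=0}^{\infty}(1-ap^k)$ and, for an integer $n\ge 0$, $(a;p)_n=\prod_{k=0}^{n-1}(1-ap^k)$. Multiple $q$-shifted factorials are products: $(a_1,\dots,a_r;p)_\infty=(a_1;p)_\infty\cdots(a_r;p)_\infty$. *)

theory Defs
  imports "HOL-Analysis.Analysis"
begin

text \<open>
  The \<open>q\<close>-shifted factorials: finite \<open>(a;p)_n\<close>, infinite \<open>(a;p)_\<infinity>\<close> (meaningful for
  \<open>norm p < 1\<close>), and multiple infinite \<open>(a_1,\<dots>,a_r;p)_\<infinity>\<close>, with the parameters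
  \<open>a_1,\<dots>,a_r\<close> given as a list.
\<close>

definition qfact :: "complex \<Rightarrow> complex \<Rightarrow> nat \<Rightarrow> complex" where
  "qfact a p n = (\<Prod>k<n. 1 - a * p ^ k)"

definition qfact_inf :: "complex \<Rightarrow> complex \<Rightarrow> complex" where
  "qfact_inf a p = (\<Prod>k. 1 - a * p ^ k)"

definition qfacts_inf :: "complex list \<Rightarrow> complex \<Rightarrow> complex" where
  "qfacts_inf as p = (\<Prod>a\<leftarrow>as. qfact_inf a p)"

end

theory Submission
  imports Defs
begin

text \<open>
  Write \<open>S_m\<close> and \<open>T_m\<close> for the series in (1) and (2). Comparing summands gives
  \<open>S_m - q S_(m+1) = T_m\<close> and \<open>T_m - T_(m+1) = q^(2m+1) (S_(m+1) + q S_(m+2))\<close>. Eliminating one family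
  yields three-term recurrences that match those of \<open>P, Q\<close> and \<open>A, B\<close> once the factors
  \<open>q^(1-m)\<close> and \<open>(q;q^2)_m\<close> are split off, so everything reduces to the values \<open>S_1\<close> and
  \<open>T_0\<close>, which are Slater's identities (50) and (29). These two follow from Bailey's lemma in base
  \<open>q^2\<close> (with one parameter sent to infinity) applied to the Bailey pairs contained in
  \<open>\<Sum>_(i+j=N) q^((j-i)(j-i+1)/2) / ((q^2;q^2)_i (q^2;q^2)_j) = 1/(q;q)_N\<close>, which leave theta series
  that the Jacobi triple product evaluates.
\<close>

subsection \<open>Convergence of shifted factorials\<close>

text \<open>In Bailey's lemma the finite parameter is \<open>a = -q\<close>, which supplies
  (-q;q^2)_n, while the parameter at infinity supplies the quadratic exponent. Taking N = 2n or N =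
  2n+1 in the finite sum and pairing i with N - i gives Bailey pairs relative to 1 and to q^2, so
  \<open>a * x\<close> must be q^2 or q^4 and x is forced to be -q or -q^3. Both values are
  fortunate: the quotient (-q;q^2)_r / (x;q^2)_r is 1 in the first case and (1+q)/(1+q^(2r+1)) in
  the second, where it cancels the extra factor of \<alpha>_r. Hence pure theta series remain. Two
  values serve two second-order recurrences because S_0 = T_0 + q S_1 and because T_1 is a
  combination of T_0 and S_1; so each right-hand side mixes both products. Infinite bilateral series
  never occur: indices at equal distance from the centre are merged into one term with r >= 0. This
  matches the (n-r, n+r) denominators of a Bailey pair and keeps every limit within reach of
  Tannery's theorem.\<close>

lemma qfact_0 [simp]: "qfact a p 0 = 1"
  by (simp add: qfact_def)

lemma qfact_Suc: "qfact a p (Suc n) = qfact a p n * (1 - a * p ^ n)"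
  by (simp add: qfact_def)

lemma qfact_add: "qfact a p (m + n) = qfact a p m * qfact (a * p ^ m) p n"
  by (induction n) (simp_all add: qfact_Suc power_add mult.assoc)

lemma qfact_factor_nz:
  fixes a p :: complex
  assumes "norm a < 1" "norm p \<le> 1"
  shows "1 - a * p ^ n \<noteq> 0"
proof
  assume "1 - a * p ^ n = 0"
  hence "norm a * norm p ^ n = 1"
    by (metis eq_iff_diff_eq_0 norm_mult norm_one norm_power)
  moreover have "norm a * norm p ^ n \<le> norm a * 1"
    using assms by (intro mult_left_mono power_le_one) auto
  ultimately show False using assms by simp
qed

lemma qfact_nz: "norm a < 1 \<Longrightarrow> norm p \<le> 1 \<Longrightarrow> qfact a p n \<noteq> 0"
  using qfact_factor_nz[of a p] by (auto simp: qfact_def)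

lemma convergent_prod_qfact:
  fixes a p :: complex
  assumes "norm p < 1"
  shows "convergent_prod (\<lambda>k. 1 - a * p ^ k)"
proof -
  have "summable (\<lambda>k. norm a * norm p ^ k)"
    using assms by (intro summable_mult summable_geometric) auto
  hence "summable (\<lambda>k. norm (- (a * p ^ k)))"
    by (simp add: norm_mult norm_power)
  hence "abs_convergent_prod (\<lambda>k. 1 - a * p ^ k)"
    by (intro summable_imp_abs_convergent_prod) simp
  thus ?thesis by (rule abs_convergent_prod_imp_convergent_prod)
qed

lemma qfact_tendsto:
  assumes "norm p < 1"
  shows "qfact a p \<longlonglongrightarrow> qfact_inf a p"
proof -
  have "(\<lambda>n. qfact a p (Suc n)) \<longlonglongrightarrow> qfact_inf a p"
    using convergent_prod_LIMSEQ[OF convergent_prod_qfact[OF assms, of a]]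
    unfolding qfact_inf_def qfact_def lessThan_Suc_atMost .
  thus ?thesis by (simp only: filterlim_sequentially_Suc)
qed

lemma qfact_inf_split:
  assumes "norm p < 1"
  shows "qfact_inf a p = qfact a p m * qfact_inf (a * p ^ m) p"
proof (rule LIMSEQ_unique)
  show "(\<lambda>n. qfact a p (n + m)) \<longlonglongrightarrow> qfact_inf a p"
    by (intro LIMSEQ_ignore_initial_segment qfact_tendsto assms)
  show "(\<lambda>n. qfact a p (n + m)) \<longlonglongrightarrow> qfact a p m * qfact_inf (a * p ^ m) p"
    unfolding add.commute[of _ m] qfact_add
    by (intro tendsto_mult tendsto_const qfact_tendsto assms)
qed

lemma qfact_inf_nz:
  assumes "norm a < 1" "norm p < 1"
  shows "qfact_inf a p \<noteq> 0"
  unfolding qfact_inf_def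
  using convergent_prod_qfact qfact_factor_nz assms by (intro prodinf_nonzero) auto

lemma qfact_bounded:
  assumes "norm p < 1"
  obtains K where "K > 0" "\<And>n. norm (qfact a p n) \<le> K"
  using qfact_tendsto[OF assms, THEN convergentI, THEN convergent_imp_Bseq, of a]
  by (auto elim!: BseqE)

lemma inverse_qfact_bounded:
  assumes "norm a < 1" "norm p < 1"
  obtains K where "K > 0" "\<And>n. norm (inverse (qfact a p n)) \<le> K"
proof -
  have "(\<lambda>n. inverse (qfact a p n)) \<longlonglongrightarrow> inverse (qfact_inf a p)"
    using assms by (intro tendsto_inverse qfact_tendsto qfact_inf_nz) auto
  from this[THEN convergentI, THEN convergent_imp_Bseq] that show thesis
    by (auto elim!: BseqE)
qed

text \<open>Consecutive terms have ratio y p^k, which tends to 0; hence y may be arbitrarily large.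
  This is the common majorant of all the series below with a quadratic exponent.\<close>

lemma summable_power_choose_two:
  fixes y p :: real
  assumes "0 \<le> y" "0 \<le> p" "p < 1"
  shows "summable (\<lambda>k. y ^ k * p ^ (k choose 2))"
proof -
  have "(\<lambda>k. y * p ^ k) \<longlonglongrightarrow> y * 0"
    using assms by (intro tendsto_mult tendsto_const LIMSEQ_power_zero) auto
  hence "eventually (\<lambda>k. y * p ^ k < 1/2) sequentially"
    by (intro order_tendstoD(2)) auto
  then obtain N where N: "\<And>k. k \<ge> N \<Longrightarrow> y * p ^ k < 1/2"
    by (auto simp: eventually_at_top_linorder)
  show ?thesis
  proof (rule summable_ratio_test[of "1/2" N])
    fix k assume "k \<ge> N"
    have "y ^ Suc k * p ^ (Suc k choose 2) = (y * p ^ k) * (y ^ k * p ^ (k choose 2))"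
      by (simp add: numeral_2_eq_2 power_add)
    also have "\<dots> \<le> 1/2 * (y ^ k * p ^ (k choose 2))"
      using N[OF \<open>k \<ge> N\<close>] assms by (intro mult_right_mono) auto
    finally show "norm (y ^ Suc k * p ^ (Suc k choose 2)) \<le> 1/2 * norm (y ^ k * p ^ (k choose 2))"
      using assms by simp
  qed simp
qed

lemma tannery_sequentially:
  fixes a :: "nat \<Rightarrow> nat \<Rightarrow> 'a :: {real_normed_algebra, banach}"
  assumes "\<And>k. (\<lambda>n. a k n) \<longlonglongrightarrow> b k" "\<And>k n. norm (a k n) \<le> M k" "summable M"
  shows "(\<lambda>n. \<Sum>k. a k n) \<longlonglongrightarrow> (\<Sum>k. b k)"
  using tannerys_theorem[of a b sequentially M] assms by (auto simp: case_prod_unfold)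

text \<open>A majorant in product form reduces Fubini to Tannery: the partial sums over n are
  bounded by \<open>suminf X * Y r\<close>, uniformly in their length.\<close>

lemma sums_swap_dominated:
  fixes f :: "nat \<Rightarrow> nat \<Rightarrow> 'a :: {real_normed_algebra, banach}"
  assumes bound: "\<And>n r. norm (f n r) \<le> X n * Y r"
    and X: "summable X" and Y: "summable Y"
  shows "(\<lambda>n. \<Sum>r. f n r) sums (\<Sum>r. \<Sum>n. f n r)"
proof -
  \<comment> \<open>\<open>X\<close> and \<open>Y\<close> are not assumed nonnegative, but their
    products dominate norms.\<close>
  have X0: "0 \<le> X n * Y r" for n r
    using bound[of n r] norm_ge_zero order_trans by blast
  have sum_r: "summable (f n)" for n
    by (rule summable_comparison_test'[where N = 0 and g = "\<lambda>r. X n * Y r"])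
       (auto intro: bound summable_mult Y)
  have sum_n: "summable (\<lambda>n. X n * Y r)" for r
    by (intro summable_mult2 X)
  have lim: "(\<lambda>N. \<Sum>n<N. f n r) \<longlonglongrightarrow> (\<Sum>n. f n r)" for r
    by (intro summable_LIMSEQ summable_comparison_test'[OF sum_n, where N = 0]) (auto intro: bound)
  have bd: "norm (\<Sum>n<N. f n r) \<le> suminf X * Y r" for N r
  proof -
    have "norm (\<Sum>n<N. f n r) \<le> (\<Sum>n<N. X n * Y r)"
      by (intro sum_norm_le bound)
    also have "\<dots> \<le> (\<Sum>n. X n * Y r)"
      by (intro sum_le_suminf sum_n) (auto intro: X0)
    finally show ?thesis by (simp add: suminf_mult2[OF X, symmetric])
  qed
  have "(\<lambda>N. \<Sum>r. \<Sum>n<N. f n r) \<longlonglongrightarrow> (\<Sum>r. \<Sum>n. f n r)"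
    by (rule tannery_sequentially[where M = "\<lambda>r. suminf X * Y r"])
       (intro lim bd summable_mult Y)+
  thus ?thesis
    unfolding sums_def by (simp add: suminf_sum sum_r)
qed

subsection \<open>The limiting \<open>q\<close>-Gauss sum and Bailey's lemma\<close>

text \<open>The summand of the basic hypergeometric series 1phi1(a; c; p, c/a) with c = a x, the
  q-Gauss series with one numerator parameter sent to infinity. With x instead of c as variable, one
  shift x -> x p moves argument and denominator parameter together.\<close>

definition phi_term :: "complex \<Rightarrow> complex \<Rightarrow> complex \<Rightarrow> nat \<Rightarrow> complex" where
  "phi_term a p x k =
     qfact a p k * (-x) ^ k * p ^ (k choose 2) / (qfact p p k * qfact (a * x) p k)"

text \<open>Uniformity in \<open>N\<close> is the point: \<open>phi_sums\<close> lets x p^N tend to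
  0 under the sum. It holds because (a x p^N;p)_k = (a x;p)_(N+k) / (a x;p)_N, where both symbols on
  the right are bounded, and bounded away from 0, by constants free of N and k.\<close>

lemma phi_term_bound:
  assumes p: "norm p < 1" and ax: "norm (a * x) < 1"
  obtains K where "K > 0"
    "\<And>N k. norm (phi_term a p (x * p ^ N) k) \<le> K * (norm x ^ k * norm p ^ (k choose 2))"
proof -
  obtain K1 where K1: "K1 > 0" "\<And>n. norm (qfact a p n) \<le> K1"
    using qfact_bounded[OF p] by blast
  obtain K2 where K2: "K2 > 0" "\<And>n. norm (inverse (qfact p p n)) \<le> K2"
    using inverse_qfact_bounded[OF p p] by blast
  obtain K3 where K3: "K3 > 0" "\<And>n. norm (inverse (qfact (a * x) p n)) \<le> K3"
    using inverse_qfact_bounded[OF ax p] by blast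
  obtain K4 where K4: "K4 > 0" "\<And>n. norm (qfact (a * x) p n) \<le> K4"
    using qfact_bounded[OF p] by blast
  show thesis
  proof (rule that[of "K1 * K2 * (K3 * K4)"])
    fix N k
    have eq: "inverse (qfact (a * (x * p ^ N)) p k)
        = inverse (qfact (a * x) p (N + k)) * qfact (a * x) p N"
      using qfact_nz[OF ax, of p N] p by (simp add: qfact_add field_simps)
    have "norm (inverse (qfact (a * (x * p ^ N)) p k)) \<le> K3 * K4"
      unfolding eq norm_mult by (intro mult_mono K3 K4) (use K3 in auto)
    moreover have "norm (x * p ^ N) ^ k \<le> norm x ^ k"
      using p by (intro power_mono) (auto simp: norm_mult norm_power intro!: mult_left_le power_le_one)
    ultimately have "norm (qfact a p k) * norm (inverse (qfact p p k))
        * norm (inverse (qfact (a * (x * p ^ N)) p k)) * (norm (x * p ^ N) ^ k * norm p ^ (k choose 2))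
      \<le> K1 * K2 * (K3 * K4) * (norm x ^ k * norm p ^ (k choose 2))"
      using K1 K2 K3 K4 by (intro mult_mono) auto
    thus "norm (phi_term a p (x * p ^ N) k) \<le> K1 * K2 * (K3 * K4) * (norm x ^ k * norm p ^ (k choose 2))"
      by (simp add: phi_term_def norm_mult norm_divide norm_power norm_inverse field_simps)
  qed (use K1 K2 K3 K4 in auto)
qed

lemma summable_phi_term:
  assumes "norm p < 1" "norm (a * x) < 1"
  shows "summable (\<lambda>k. norm (phi_term a p x k))"
proof -
  obtain K where K: "\<And>N k. norm (phi_term a p (x * p ^ N) k) \<le> K * (norm x ^ k * norm p ^ (k choose 2))"
    using phi_term_bound[OF assms] by metis
  show ?thesis
    by (rule summable_comparison_test'[where N = 0
        and g = "\<lambda>k. K * (norm x ^ k * norm p ^ (k choose 2))"])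
       (use K[of 0] assms in \<open>auto intro!: summable_mult summable_power_choose_two\<close>)
qed

text \<open>The difference of the two sides telescopes with \<open>g k = (1 - a x) (1 - p^k) t_k\<close>, \<open>t_k\<close> the summand.\<close>

lemma phi_functional_equation:
  assumes p: "norm p < 1" and ax: "norm (a * x) < 1"
  shows "(1 - a * x) * (\<Sum>k. phi_term a p x k) = (1 - x) * (\<Sum>k. phi_term a p (x * p) k)"
proof -
  have axp: "norm (a * (x * p)) < 1"
  proof -
    have "norm (a * x) * norm p \<le> norm (a * x) * 1"
      using p by (intro mult_left_mono) auto
    thus ?thesis using ax by (simp add: norm_mult mult.assoc)
  qed
  note s1 = summable_norm_cancel[OF summable_phi_term[OF p ax]]
  note s2 = summable_norm_cancel[OF summable_phi_term[OF p axp]]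
  define g where "g = (\<lambda>k. (1 - a * x) * (1 - p ^ k) * phi_term a p x k)"
  have step: "(1 - a * x) * phi_term a p x k - (1 - x) * phi_term a p (x * p) k = g k - g (Suc k)" for k
  proof -
    define y where "y = p ^ k"
    have nz: "1 - p * y \<noteq> 0" "1 - a * x * y \<noteq> 0" "1 - a * x \<noteq> 0"
      using qfact_factor_nz[OF p, of p k] qfact_factor_nz[OF ax, of p k]
        qfact_factor_nz[OF ax, of p 0] p by (auto simp: y_def)
    define D where "D = qfact (a * (x * p)) p k"
    have q1: "qfact (a * x) p (Suc k) = (1 - a * x) * D"
      using qfact_add[of "a * x" p 1 k] by (simp add: D_def qfact_Suc mult.assoc)
    hence q2: "qfact (a * x) p k * (1 - a * x * y) = (1 - a * x) * D"
      by (simp add: qfact_Suc y_def)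
    have Dnz: "D \<noteq> 0" "qfact (a * x) p k \<noteq> 0" "qfact p p k \<noteq> 0"
      using qfact_nz p ax axp by (auto simp: D_def)
    \<comment> \<open>The shift contributes p^k through x^k, and it replaces the first factor 1 - a
      x of the denominator symbol by the next one, 1 - a x p^k.\<close>
    have t2: "phi_term a p (x * p) k = phi_term a p x k * y * (1 - a * x) / (1 - a * x * y)"
    proof -
      have "phi_term a p (x * p) k
          = qfact a p k * (-x) ^ k * p ^ (k choose 2) * y / (qfact p p k * D)"
        unfolding phi_term_def D_def y_def using power_mult_distrib[of "-x" p k] by simp
      also have "D = qfact (a * x) p k * (1 - a * x * y) / (1 - a * x)"
        using q2 nz by (simp add: field_simps)
      finally show ?thesis
        using nz Dnz by (simp add: phi_term_def)
    qed
    have t3: "phi_term a p x (Suc k) * (1 - p * y)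
        = phi_term a p x k * (1 - a * y) * (- x) * y / (1 - a * x * y)"
      using nz Dnz by (simp add: phi_term_def qfact_Suc numeral_2_eq_2 power_add mult_ac flip: y_def)
    have "g k - g (Suc k) = (1 - a * x) * ((1 - y) * phi_term a p x k
        - phi_term a p x (Suc k) * (1 - p * y))"
      by (simp add: g_def y_def algebra_simps)
    also have "\<dots> = (1 - a * x) * phi_term a p x k * ((1 - y) + (1 - a * y) * x * y / (1 - a * x * y))"
    proof -
      have "b * ((1 - y) * T - T * z * (- x) * y / d) = b * T * ((1 - y) + z * x * y / d)"
        for b T z d :: complex
        by (simp add: algebra_simps)
      thus ?thesis unfolding t3 .
    qed
    also have "(1 - y) + (1 - a * y) * x * y / (1 - a * x * y) = 1 - (1 - x) * y / (1 - a * x * y)"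
      using nz by (simp add: divide_simps) (simp add: algebra_simps)
    finally have "g k - g (Suc k)
        = (1 - a * x) * phi_term a p x k * (1 - (1 - x) * y / (1 - a * x * y))" .
    moreover have "b * T - z * (T * y * b / d) = b * T * (1 - z * y / d)" for b T z d :: complex
      by (simp add: right_diff_distrib mult_ac)
    ultimately show ?thesis
      unfolding t2 by simp
  qed
  \<comment> \<open>Both ends of the telescope vanish: \<open>g 0\<close> through the factor 1 -
    p^0, and the limit because the summand tends to 0.\<close>
  have "g \<longlonglongrightarrow> (1 - a * x) * (1 - 0) * 0"
    unfolding g_def using p
    by (intro tendsto_intros LIMSEQ_power_zero summable_LIMSEQ_zero s1) auto
  hence "(\<lambda>k. g k - g (Suc k)) sums (g 0 - 0)"
    by (intro telescope_sums') simp
  hence "(\<lambda>k. g k - g (Suc k)) sums 0"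
    by (simp add: g_def)
  moreover have "(\<lambda>k. (1 - a * x) * phi_term a p x k - (1 - x) * phi_term a p (x * p) k) sums
      ((1 - a * x) * (\<Sum>k. phi_term a p x k) - (1 - x) * (\<Sum>k. phi_term a p (x * p) k))"
    by (intro sums_diff sums_mult summable_sums s1 s2)
  ultimately have "(1 - a * x) * (\<Sum>k. phi_term a p x k) - (1 - x) * (\<Sum>k. phi_term a p (x * p) k) = 0"
    unfolding step by (metis sums_unique2)
  thus ?thesis by simp
qed

text \<open>Iterating the functional equation gives F(x) (a x;p)_N = (x;p)_N F(x p^N). As N grows,
  only the term k = 0 of F(x p^N) survives, so the last factor tends to 1.\<close>

lemma phi_sums:
  assumes p: "norm p < 1" and ax: "norm (a * x) < 1"
  shows "phi_term a p x sums (qfact_inf x p / qfact_inf (a * x) p)"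
proof -
  define F where "F = (\<lambda>x. \<Sum>k. phi_term a p x k)"
  have small: "norm (a * (x * p ^ N)) < 1" for N
  proof -
    have "norm (a * x) * norm p ^ N \<le> norm (a * x) * 1"
      using p by (intro mult_left_mono power_le_one) auto
    thus ?thesis using ax by (simp add: norm_mult norm_power mult.assoc)
  qed
  have iter: "F x * qfact (a * x) p N = qfact x p N * F (x * p ^ N)" for N
  proof (induction N)
    case (Suc N)
    have "F x * qfact (a * x) p (Suc N) = (F x * qfact (a * x) p N) * (1 - a * (x * p ^ N))"
      by (simp add: qfact_Suc mult.assoc)
    also have "\<dots> = qfact x p N * ((1 - a * (x * p ^ N)) * F (x * p ^ N))"
      by (simp add: Suc)
    also have "(1 - a * (x * p ^ N)) * F (x * p ^ N) = (1 - x * p ^ N) * F (x * p ^ N * p)"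
      unfolding F_def by (rule phi_functional_equation[OF p small])
    finally show ?case by (simp add: qfact_Suc mult_ac)
  qed simp
  obtain K where K: "\<And>N k. norm (phi_term a p (x * p ^ N) k) \<le> K * (norm x ^ k * norm p ^ (k choose 2))"
    using phi_term_bound[OF p ax] by metis
  \<comment> \<open>For k > 0 the factor (p^N)^k tends to 0, while the quotient of the two
    denominator symbols converges.\<close>
  have lim: "(\<lambda>N. phi_term a p (x * p ^ N) k) \<longlonglongrightarrow> (if k = 0 then 1 else 0)" for k
  proof (cases "k = 0")
    case False
    have eq: "phi_term a p (x * p ^ N) k = (qfact a p k * (-x) ^ k * p ^ (k choose 2) / qfact p p k)
        * ((p ^ N) ^ k * (qfact (a * x) p N * inverse (qfact (a * x) p (N + k))))" for N
    proof -
      have "(- (x * p ^ N)) ^ k = (-x) ^ k * (p ^ N) ^ k"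
        using power_mult_distrib[of "-x" "p ^ N" k] by simp
      thus ?thesis
        using qfact_nz[OF ax, of p N] p by (simp add: phi_term_def qfact_add field_simps)
    qed
    have "(\<lambda>N. p ^ N) \<longlonglongrightarrow> 0" using p by (rule LIMSEQ_power_zero)
    hence 1: "(\<lambda>N. (p ^ N) ^ k) \<longlonglongrightarrow> 0"
      using False by (metis tendsto_power power_0_left)
    have 2: "(\<lambda>N. qfact (a * x) p N * inverse (qfact (a * x) p (N + k)))
        \<longlonglongrightarrow> qfact_inf (a * x) p * inverse (qfact_inf (a * x) p)"
      by (intro tendsto_intros qfact_tendsto LIMSEQ_ignore_initial_segment qfact_inf_nz p ax)
    show ?thesis
      unfolding eq using tendsto_mult_right_zero[OF tendsto_mult_left_zero[OF 1]] False
      using tendsto_mult[OF tendsto_const tendsto_mult[OF 1 2]] by (simp only: mult_zero_left mult_zero_right if_False)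
  qed (simp add: phi_term_def numeral_2_eq_2)
  have "(\<lambda>N. F (x * p ^ N)) \<longlonglongrightarrow> (\<Sum>k. if k = 0 then 1 else 0)"
    unfolding F_def
    by (rule tannery_sequentially[where M = "\<lambda>k. K * (norm x ^ k * norm p ^ (k choose 2))"])
       (rule lim, rule K, use p in \<open>auto intro!: summable_mult summable_power_choose_two\<close>)
  also have "(\<Sum>k::nat. if k = 0 then 1 else 0 :: complex) = 1"
    by (subst suminf_finite[of "{0}"]) auto
  finally have "(\<lambda>N. qfact x p N * F (x * p ^ N)) \<longlonglongrightarrow> qfact_inf x p * 1"
    by (intro tendsto_mult qfact_tendsto p)
  moreover have "(\<lambda>N. F x * qfact (a * x) p N) \<longlonglongrightarrow> F x * qfact_inf (a * x) p"
    by (intro tendsto_mult tendsto_const qfact_tendsto p)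
  ultimately have "F x * qfact_inf (a * x) p = qfact_inf x p"
    unfolding iter by (simp add: LIMSEQ_unique)
  hence "F x = qfact_inf x p / qfact_inf (a * x) p"
    using qfact_inf_nz[OF ax p] by (simp add: field_simps)
  thus ?thesis
    using summable_sums[OF summable_norm_cancel[OF summable_phi_term[OF p ax]]]
    by (simp add: F_def)
qed

lemma choose_two_Suc: "Suc n choose 2 = (n choose 2) + n"
  by (simp add: numeral_2_eq_2)

lemma choose_two_add: "(m + n) choose 2 = (m choose 2) + (n choose 2) + m * n"
  by (induction n) (auto simp: choose_two_Suc binomial_eq_0)

text \<open>Here \<open>a * x\<close> plays the role of \<open>aq\<close> in the usual notation for Bailey pairs relative to \<open>a\<close>.\<close>

theorem bailey_lemma:
  assumes p: "norm p < 1" and x: "norm x < 1" and ax: "norm (a * x) < 1"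
    and \<alpha>: "summable (\<lambda>r. norm (\<alpha> r))"
    and \<beta>: "\<And>n. \<beta> n = (\<Sum>r\<le>n. \<alpha> r / (qfact p p (n - r) * qfact (a * x) p (n + r)))"
  shows "(\<lambda>n. qfact a p n * (-x) ^ n * p ^ (n choose 2) * \<beta> n) sums
    (qfact_inf x p / qfact_inf (a * x) p *
      (\<Sum>r. qfact a p r * (-x) ^ r * p ^ (r choose 2) / qfact x p r * \<alpha> r))"
proof -
  define w where "w = (\<lambda>n. qfact a p n * (-x) ^ n * p ^ (n choose 2))"
  \<comment> \<open>Extending by 0 above the diagonal turns the triangular sum into one over all
    pairs, so that the general exchange of summations applies.\<close>
  define f where "f = (\<lambda>n r. if r \<le> n then
    w n * \<alpha> r / (qfact p p (n - r) * qfact (a * x) p (n + r)) else 0)"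
  have row: "(\<Sum>r. f n r) = w n * \<beta> n" for n
  proof -
    have "(\<Sum>r. f n r) = (\<Sum>r\<le>n. f n r)"
      by (rule suminf_finite) (auto simp: f_def)
    also have "\<dots> = w n * \<beta> n"
      unfolding \<beta> sum_distrib_left by (intro sum.cong) (auto simp: f_def)
    finally show ?thesis .
  qed
  \<comment> \<open>Column r starts at n = r; after n = k + r it is a constant multiple of the
    \<open>phi_term\<close> series with parameters a p^r and x p^r, whose sum is known.\<close>
  have col: "(\<lambda>n. f n r) sums (qfact_inf x p / qfact_inf (a * x) p * (w r / qfact x p r * \<alpha> r))" for r
  proof -
    have ax': "norm ((a * p ^ r) * (x * p ^ r)) < 1"
    proof -
      have "norm (a * x) * norm (p ^ r * p ^ r) \<le> norm (a * x) * 1"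
        using p unfolding power_add[symmetric] by (intro mult_left_mono) (auto simp: norm_power power_le_one)
      thus ?thesis using ax by (simp add: norm_mult mult_ac)
    qed
    have e: "(a * p ^ r) * (x * p ^ r) = (a * x) * p ^ (r + r)"
      by (simp add: power_add mult_ac)
    have eq: "f (k + r) r = w r * \<alpha> r / qfact (a * x) p (r + r)
        * phi_term (a * p ^ r) p (x * p ^ r) k" for k
    proof -
      have 1: "k + r - r = k" "k + r + r = (r + r) + k" by auto
      have 2: "w (k + r) = w r * (qfact (a * p ^ r) p k * (- (x * p ^ r)) ^ k * p ^ (k choose 2))"
        using power_mult_distrib[of "-x" "p ^ r" k]
        unfolding w_def add.commute[of k r] qfact_add choose_two_add
        by (simp add: power_add mult_ac flip: power_mult)
      show ?thesis
        unfolding f_def phi_term_def 1 2 e qfact_add[of "a * x" p "r + r" k] by (simp add: mult_ac)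
    qed
    have "qfact_inf (x * p ^ r) p / qfact_inf (a * x * p ^ (r + r)) p
        = qfact (a * x) p (r + r) / qfact x p r * (qfact_inf x p / qfact_inf (a * x) p)"
      using qfact_inf_split[OF p, of x r] qfact_inf_split[OF p, of "a * x" "r + r"]
        qfact_nz[OF x, of p r] qfact_nz[OF ax, of p "r + r"] p by simp
    hence "(\<lambda>k. f (k + r) r) sums (w r * \<alpha> r / qfact (a * x) p (r + r)
        * (qfact (a * x) p (r + r) / qfact x p r * (qfact_inf x p / qfact_inf (a * x) p)))"
      unfolding eq using sums_mult[OF phi_sums[OF p ax']] e by metis
    hence "(\<lambda>k. f (k + r) r) sums (qfact_inf x p / qfact_inf (a * x) p * (w r / qfact x p r * \<alpha> r))"
      using qfact_nz[OF ax, of p "r + r"] p by (simp add: mult_ac)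
    thus ?thesis
      by (subst (asm) sums_zero_iff_shift) (auto simp: f_def)
  qed
  obtain K1 where K1: "K1 > 0" "\<And>n. norm (qfact a p n) \<le> K1"
    using qfact_bounded[OF p] by blast
  obtain K2 where K2: "K2 > 0" "\<And>n. norm (inverse (qfact p p n)) \<le> K2"
    using inverse_qfact_bounded[OF p p] by blast
  obtain K3 where K3: "K3 > 0" "\<And>n. norm (inverse (qfact (a * x) p n)) \<le> K3"
    using inverse_qfact_bounded[OF ax p] by blast
  \<comment> \<open>The factors depending on n - r and n + r are replaced by uniform bounds; this
    separates the variables n and r in the majorant.\<close>
  define X where "X = (\<lambda>n. K1 * K2 * K3 * (norm x ^ n * norm p ^ (n choose 2)))"
  have bound: "norm (f n r) \<le> X n * norm (\<alpha> r)" for n r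
  proof (cases "r \<le> n")
    case True
    have "norm (f n r) = norm (qfact a p n) * norm (inverse (qfact p p (n - r)))
        * norm (inverse (qfact (a * x) p (n + r))) * (norm x ^ n * norm p ^ (n choose 2)) * norm (\<alpha> r)"
      using True by (simp add: f_def w_def norm_mult norm_divide norm_inverse norm_power divide_inverse mult_ac)
    also have "\<dots> \<le> X n * norm (\<alpha> r)"
      unfolding X_def using K1 K2 K3 by (intro mult_mono) auto
    finally show ?thesis .
  next
    case False
    thus ?thesis using K1 K2 K3 by (auto simp: f_def X_def)
  qed
  have X: "summable X"
    unfolding X_def using p by (intro summable_mult summable_power_choose_two) auto
  have "(\<lambda>n. \<Sum>r. f n r) sums (\<Sum>r. \<Sum>n. f n r)"
    by (rule sums_swap_dominated[OF bound X \<alpha>])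
  \<comment> \<open>Summability is what allows the infinite-product prefactor to be pulled out of
    the sum over r at the end.\<close>
  moreover have "summable (\<lambda>r. w r / qfact x p r * \<alpha> r)"
  proof -
    obtain K4 where K4: "K4 > 0" "\<And>n. norm (inverse (qfact x p n)) \<le> K4"
      using inverse_qfact_bounded[OF x p] by blast
    show ?thesis
    proof (rule summable_comparison_test'[where N = 0])
      show "summable (\<lambda>r. K1 * K4 * norm (\<alpha> r))"
        by (intro summable_mult \<alpha>)
      fix r :: nat
      have "norm (w r / qfact x p r * \<alpha> r) = norm (qfact a p r) * norm (inverse (qfact x p r))
          * (norm x ^ r * norm p ^ (r choose 2)) * norm (\<alpha> r)"
        by (simp add: w_def norm_mult norm_divide norm_inverse norm_power divide_inverse mult_ac)
      also have "\<dots> \<le> K1 * K4 * 1 * norm (\<alpha> r)"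
        using K1 K4 p x by (intro mult_mono mult_le_one power_le_one) auto
      finally show "norm (w r / qfact x p r * \<alpha> r) \<le> K1 * K4 * norm (\<alpha> r)" by simp
    qed
  qed
  ultimately show ?thesis
    unfolding row sums_unique[OF col, symmetric] w_def by (simp only: suminf_mult)
qed

subsection \<open>Finite sums and the Jacobi triple product\<close>

lemma qfact_p_Suc: "qfact p p (Suc n) = qfact p p n * (1 - p ^ Suc n)"
  by (simp add: qfact_Suc)

text \<open>The factor 1 - p^i kills the term i = 0 and elsewhere cancels the last factor of
  (p;p)_i. Splitting 1 - p^(N+1) into multiples of 1 - p^i and 1 - p^(N+1-i) makes this lemma and
  its mirror image together the q-Pascal rule.\<close>

lemma sum_pascal_left:
  assumes "norm p < 1"
  shows "(\<Sum>i\<le>Suc N. g i * (1 - p ^ i) / (qfact p p i * qfact p p (Suc N - i)))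
    = (\<Sum>i\<le>N. g (Suc i) / (qfact p p i * qfact p p (N - i)))"
proof -
  have nz: "p ^ Suc i \<noteq> 1" for i
    using qfact_factor_nz[OF assms, of p i] assms by simp
  show ?thesis
    unfolding sum.atMost_Suc_shift by (simp add: qfact_p_Suc nz del: power_Suc)
qed

lemma sum_pascal_right:
  assumes "norm p < 1"
  shows "(\<Sum>i\<le>Suc N. g i * (1 - p ^ (Suc N - i)) / (qfact p p i * qfact p p (Suc N - i)))
    = (\<Sum>i\<le>N. g i / (qfact p p i * qfact p p (N - i)))"
proof -
  have nz: "p ^ Suc i \<noteq> 1" for i
    using qfact_factor_nz[OF assms, of p i] assms by simp
  show ?thesis
    by (simp add: qfact_p_Suc nz Suc_diff_le del: power_Suc)
qed

text \<open>Summation from the centre outwards, producing the (n-r, n+r) shape of a Bailey pair; the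
  central index must be counted only once. The induction enlarges a window of radius
  \<open>m\<close> by its two new endpoints.\<close>

lemma sum_fold_even:
  fixes f :: "nat \<Rightarrow> 'a :: comm_monoid_add"
  shows "(\<Sum>i\<le>2*n. f i) = (\<Sum>r\<le>n. if r = 0 then f n else f (n - r) + f (n + r))"
proof -
  have "(\<Sum>r\<le>m. if r = 0 then f n else f (n - r) + f (n + r)) = sum f {n-m..n+m}" if "m \<le> n" for m
    using that
  proof (induction m)
    case (Suc m)
    have "{n - Suc m..n + Suc m} = insert (n - Suc m) (insert (n + Suc m) {n-m..n+m})"
      using Suc.prems by auto
    hence "sum f {n - Suc m..n + Suc m} = f (n - Suc m) + (f (n + Suc m) + sum f {n-m..n+m})"
      using Suc.prems by (simp only:) (subst sum.insert; auto)+
    thus ?case using Suc.IH Suc.prems by (simp add: add_ac)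
  qed simp
  from this[of n] show ?thesis by (simp add: mult_2 atMost_atLeast0)
qed

text \<open>Here two indices, n and n + 1, share the centre, so r = 0 is no exception.\<close>

lemma sum_fold_odd:
  fixes f :: "nat \<Rightarrow> 'a :: comm_monoid_add"
  shows "(\<Sum>i\<le>2*n+1. f i) = (\<Sum>r\<le>n. f (n - r) + f (n + r + 1))"
proof -
  have "(\<Sum>r\<le>m. f (n - r) + f (n + r + 1)) = sum f {n-m..n+m+1}" if "m \<le> n" for m
    using that
  proof (induction m)
    case 0
    have "{n..n+1} = {n, Suc n}" by auto
    thus ?case by simp
  next
    case (Suc m)
    have "{n - Suc m..n + Suc m + 1} = insert (n - Suc m) (insert (n + Suc m + 1) {n-m..n+m+1})"
      using Suc.prems by auto
    hence "sum f {n - Suc m..n + Suc m + 1} = f (n - Suc m) + (f (n + Suc m + 1) + sum f {n-m..n+m+1})"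
      using Suc.prems by (simp only:) (subst sum.insert; auto)+
    thus ?case using Suc.IH Suc.prems by (simp add: add_ac del: sum.cl_ivl_Suc)
  qed
  from this[of n] show ?thesis by (simp add: mult_2 atMost_atLeast0)
qed

text \<open>
  Calling the left side \<open>L_N\<close>, reversing the order of summation in \<open>q^N L_N\<close> and then subtracting
  from \<open>L_N\<close> produces the factor \<open>1 - q^(2i)\<close>, whence \<open>(1 - q^N) L_N = L_(N-1)\<close>.
\<close>

lemma sum_triangular_powers:
  fixes q :: complex
  assumes q: "q \<noteq> 0" "norm q < 1"
  defines "c \<equiv> \<lambda>d :: int. q powi (d * (d + 1) div 2)"
  shows "(\<Sum>i\<le>N. c (int N - 2 * int i) / (qfact (q^2) (q^2) i * qfact (q^2) (q^2) (N - i)))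
    = 1 / qfact q q N"
proof (induction N)
  case 0
  show ?case by (simp add: c_def)
next
  case (Suc N)
  define E where "E = (\<lambda>N i. qfact (q^2) (q^2) i * qfact (q^2) (q^2) (N - i))"
  have q2: "norm (q^2) < 1" using q by (simp add: norm_power power_less_one_iff)
  have c_uminus: "c d = c (- d) * q powi d" for d
  proof -
    \<comment> \<open>The two numerators differ by a multiple of 2, so the integer division splits
      without any parity argument.\<close>
    have "d * (d + 1) = (- d) * (- d + 1) + d * 2" by (simp add: algebra_simps)
    hence h: "d * (d + 1) div 2 = (- d) * (- d + 1) div 2 + d"
      by (simp only: div_mult_self1)
    show ?thesis unfolding c_def h using q by (subst power_int_add) auto
  qed
  have c_refl: "c (- d - 1) = c d" for d
    by (simp add: c_def algebra_simps)
  have rev: "(\<Sum>i\<le>M. c (int M - 2 * int i) / E M i) = (\<Sum>i\<le>M. c (2 * int i - int M) / E M i)" for M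
    by (rule sum.reindex_bij_witness[of _ "\<lambda>i. M - i" "\<lambda>i. M - i"])
       (auto simp: E_def of_nat_diff mult.commute algebra_simps)
  have "q ^ Suc N * (\<Sum>i\<le>Suc N. c (int (Suc N) - 2 * int i) / E (Suc N) i)
      = (\<Sum>i\<le>Suc N. c (int (Suc N) - 2 * int i) * (q^2) ^ i / E (Suc N) i)"
    unfolding rev sum_distrib_left
  proof (intro sum.cong refl)
    fix i
    have "q powi (int (Suc N)) = q powi (int (Suc N) - 2 * int i) * q powi (2 * int i)"
      using q by (subst power_int_add[symmetric]) auto
    hence "q ^ Suc N = q powi (int (Suc N) - 2 * int i) * (q^2) ^ i"
      by (metis power_int_of_nat of_nat_mult of_nat_numeral power_mult)
    thus "q ^ Suc N * (c (2 * int i - int (Suc N)) / E (Suc N) i)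
        = c (int (Suc N) - 2 * int i) * (q^2) ^ i / E (Suc N) i"
      using c_uminus[of "int (Suc N) - 2 * int i"] by (simp add: mult_ac)
  qed
  hence "(1 - q ^ Suc N) * (\<Sum>i\<le>Suc N. c (int (Suc N) - 2 * int i) / E (Suc N) i)
      = (\<Sum>i\<le>Suc N. c (int (Suc N) - 2 * int i) * (1 - (q^2) ^ i) / E (Suc N) i)"
    by (simp add: left_diff_distrib right_diff_distrib sum_subtractf diff_divide_distrib del: sum.atMost_Suc power_Suc)
  also have "\<dots> = (\<Sum>i\<le>N. c (int (Suc N) - 2 * int (Suc i)) / E N i)"
    unfolding E_def by (rule sum_pascal_left[OF q2])
  \<comment> \<open>The map d -> -d-1 fixes triangular numbers and sends N-1-2i to 2i-N, which gives
    the reversed form of the sum for N.\<close>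
  also have "\<dots> = (\<Sum>i\<le>N. c (2 * int i - int N) / E N i)"
  proof (intro sum.cong refl)
    fix i
    have "int (Suc N) - 2 * int (Suc i) = - (2 * int i - int N) - 1" by simp
    thus "c (int (Suc N) - 2 * int (Suc i)) / E N i = c (2 * int i - int N) / E N i"
      by (simp only: c_refl)
  qed
  also have "\<dots> = 1 / qfact q q N"
    unfolding rev[symmetric] using Suc by (simp add: E_def)
  finally have "(1 - q ^ Suc N) * (\<Sum>i\<le>Suc N. c (int (Suc N) - 2 * int i) / E (Suc N) i) = 1 / qfact q q N" .
  moreover have "1 - q ^ Suc N \<noteq> 0"
    using qfact_factor_nz[of q q N] q by simp
  moreover have "s = 1 / (y * z)" if "z * s = 1 / y" "z \<noteq> 0" for s y z :: complex
    using that by (metis divide_divide_eq_left nonzero_mult_div_cancel_left)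
  ultimately show ?case
    unfolding E_def qfact_p_Suc by blast
qed

text \<open>
  Cauchy's finite form with two independent lengths \<open>m, n\<close>, so that each can be raised separately
  by the \<open>q\<close>-Pascal rules.
\<close>

lemma finite_jacobi_triple:
  fixes u v :: complex
  assumes uv: "u \<noteq> 0" "v \<noteq> 0" and P: "norm (u * v) < 1"
  defines "p \<equiv> u * v"
  defines "c \<equiv> \<lambda>r :: int. u powi r * p powi (r * (r - 1) div 2)"
  shows "(\<Sum>i\<le>m+n. c (int m - int i) / (qfact p p i * qfact p p (m + n - i)))
    = qfact (-u) p m * qfact (-v) p n / qfact p p (m + n)"
proof -
  define E where "E = (\<lambda>N i. qfact p p i * qfact p p (N - i))"
  define X where "X = (\<lambda>m n. \<Sum>i\<le>m+n. c (int m - int i) / E (m + n) i)"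
  have p: "norm p < 1" "p \<noteq> 0" using uv P by (auto simp: p_def)
  have c_Suc: "c (r + 1) = c r * u * p powi r" for r
  proof -
    have "(r + 1) * (r + 1 - 1) = r * (r - 1) + r * 2" by (simp add: algebra_simps)
    hence h: "(r + 1) * (r + 1 - 1) div 2 = r * (r - 1) div 2 + r"
      by (simp only: div_mult_self1)
    show ?thesis unfolding c_def h using uv p by (simp add: power_int_add)
  qed
  have nz: "1 - p ^ Suc i \<noteq> 0" for i
    using qfact_factor_nz[OF p(1), of p i] p by simp
  \<comment> \<open>The split is 1 - p^(M+1) = (1 - p^i) + p^i (1 - p^(M+1-i)). In the first part
    the index shift undoes the raise of m; in the second, p^i turns c(m+1-i) into c(m-i) u
    p^m.\<close>
  have step1: "(1 - p ^ Suc (m + n)) * X (Suc m) n = (1 + u * p ^ m) * X m n" for m n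
  proof -
    define M where "M = m + n"
    have "(1 - p ^ Suc M) * X (Suc m) n
      = (\<Sum>i\<le>Suc M. c (int (Suc m) - int i) * (1 - p ^ i) / E (Suc M) i)
        + (\<Sum>i\<le>Suc M. (c (int (Suc m) - int i) * p ^ i) * (1 - p ^ (Suc M - i)) / E (Suc M) i)"
      unfolding X_def sum_distrib_left sum.distrib[symmetric] add_Suc M_def[symmetric]
    proof (intro sum.cong refl)
      fix i assume "i \<in> {..Suc M}"
      hence "p ^ Suc M = p ^ i * p ^ (Suc M - i)"
        by (subst power_add[symmetric]) auto
      thus "(1 - p ^ Suc M) * (c (int (Suc m) - int i) / E (Suc M) i)
        = c (int (Suc m) - int i) * (1 - p ^ i) / E (Suc M) i
          + (c (int (Suc m) - int i) * p ^ i) * (1 - p ^ (Suc M - i)) / E (Suc M) i"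
        by (simp add: divide_inverse algebra_simps del: power_Suc)
    qed
    also have "\<dots> = (\<Sum>i\<le>M. c (int (Suc m) - int (Suc i)) / E M i)
        + (\<Sum>i\<le>M. c (int (Suc m) - int i) * p ^ i / E M i)"
      unfolding E_def sum_pascal_left[OF p(1)] sum_pascal_right[OF p(1)] ..
    also have "\<dots> = (1 + u * p ^ m) * X m n"
      unfolding X_def sum_distrib_left sum.distrib[symmetric] M_def[symmetric]
    proof (intro sum.cong refl)
      fix i
      have "p powi (int m - int i) * p ^ i = p ^ m"
        using p power_int_add[of p "int m - int i" "int i"] by simp
      hence "c (int (Suc m) - int i) * p ^ i = c (int m - int i) * (u * p ^ m)"
        using c_Suc[of "int m - int i"] by (simp add: algebra_simps)
      thus "c (int (Suc m) - int (Suc i)) / E M i + c (int (Suc m) - int i) * p ^ i / E M i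
          = (1 + u * p ^ m) * (c (int m - int i) / E M i)"
        by (simp add: divide_inverse algebra_simps)
    qed
    finally show ?thesis by (simp add: M_def)
  qed
  \<comment> \<open>Raising n leaves the arguments of \<open>c\<close> alone, so the opposite split
    p^(M+1-i) (1 - p^i) + (1 - p^(M+1-i)) is used; the shifted part yields v p^n because v = p /
    u.\<close>
  have step2: "(1 - p ^ Suc (m + n)) * X m (Suc n) = (1 + v * p ^ n) * X m n" for m n
  proof -
    define M where "M = m + n"
    have "(1 - p ^ Suc M) * X m (Suc n)
      = (\<Sum>i\<le>Suc M. (c (int m - int i) * p ^ (Suc M - i)) * (1 - p ^ i) / E (Suc M) i)
        + (\<Sum>i\<le>Suc M. c (int m - int i) * (1 - p ^ (Suc M - i)) / E (Suc M) i)"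
      unfolding X_def sum_distrib_left sum.distrib[symmetric] add_Suc_right M_def[symmetric]
    proof (intro sum.cong refl)
      fix i assume "i \<in> {..Suc M}"
      hence "p ^ Suc M = p ^ i * p ^ (Suc M - i)"
        by (subst power_add[symmetric]) auto
      thus "(1 - p ^ Suc M) * (c (int m - int i) / E (Suc M) i)
        = (c (int m - int i) * p ^ (Suc M - i)) * (1 - p ^ i) / E (Suc M) i
          + c (int m - int i) * (1 - p ^ (Suc M - i)) / E (Suc M) i"
        by (simp add: divide_inverse algebra_simps del: power_Suc)
    qed
    also have "\<dots> = (\<Sum>i\<le>M. c (int m - int (Suc i)) * p ^ (Suc M - Suc i) / E M i)
        + (\<Sum>i\<le>M. c (int m - int i) / E M i)"
      unfolding E_def sum_pascal_left[OF p(1)] sum_pascal_right[OF p(1)] ..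
    also have "\<dots> = (1 + v * p ^ n) * X m n"
      unfolding X_def sum_distrib_left sum.distrib[symmetric] M_def[symmetric]
    proof (intro sum.cong refl)
      fix i assume "i \<in> {..M}"
      hence "int (M - i) = (int m - int (Suc i)) + int (Suc n)"
        by (auto simp: M_def)
      hence "p ^ (M - i) = p powi (int m - int (Suc i)) * p ^ Suc n"
        using p by (metis power_int_add power_int_of_nat)
      moreover have "c (int m - int i) = c (int m - int (Suc i)) * u * p powi (int m - int (Suc i))"
        using c_Suc[of "int m - int (Suc i)"] by simp
      ultimately have "c (int m - int (Suc i)) * p ^ (M - i) = c (int m - int i) * (v * p ^ n)"
        by (simp add: p_def mult_ac)
      thus "c (int m - int (Suc i)) * p ^ (Suc M - Suc i) / E M i + c (int m - int i) / E M i
          = (1 + v * p ^ n) * (c (int m - int i) / E M i)"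
        by (simp add: divide_inverse algebra_simps)
    qed
    finally show ?thesis by (simp add: M_def)
  qed
  have "X m 0 = qfact (-u) p m / qfact p p m"
  proof (induction m)
    case (Suc m)
    have "X (Suc m) 0 = (1 + u * p ^ m) * X m 0 / (1 - p ^ Suc m)"
      using step1[of m 0] nz[of m] by (simp add: field_simps del: power_Suc)
    thus ?case using Suc by (simp add: qfact_p_Suc qfact_Suc[of "-u"] mult_ac del: power_Suc)
  qed (simp add: X_def E_def c_def)
  hence "X m n = qfact (-u) p m * qfact (-v) p n / qfact p p (m + n)"
  proof (induction n)
    case (Suc n)
    have "X m (Suc n) = (1 + v * p ^ n) * X m n / (1 - p ^ Suc (m + n))"
      using step2[of m n] nz[of "m + n"] by (simp add: field_simps del: power_Suc)
    thus ?case using Suc by (simp add: qfact_p_Suc qfact_Suc[of "-v"] mult_ac del: power_Suc)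
  qed simp
  thus ?thesis by (simp add: X_def E_def)
qed


text \<open>The bilateral series of u^r p^(r(r-1)/2) with r and -r merged: since v = p / u, the term
  at -r is v^r p^(r(r-1)/2), and no negative powers are needed. It is the limit of the finite form
  with both lengths equal to n.\<close>

theorem jacobi_triple_product:
  fixes u v :: complex
  assumes uv: "u \<noteq> 0" "v \<noteq> 0" and P: "norm (u * v) < 1"
  shows "(\<lambda>r. if r = 0 then 1 else (u ^ r + v ^ r) * (u * v) ^ (r choose 2)) sums
    (qfact_inf (-u) (u * v) * qfact_inf (-v) (u * v) * qfact_inf (u * v) (u * v))"
proof -
  define p where "p = u * v"
  have p: "norm p < 1" "p \<noteq> 0" using uv P by (auto simp: p_def)
  define \<alpha> where "\<alpha> = (\<lambda>r. if r = 0 then 1 else (u ^ r + v ^ r) * p ^ (r choose 2))"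
  have bound: "norm (\<alpha> r) \<le> norm u ^ r * norm p ^ (r choose 2) + norm v ^ r * norm p ^ (r choose 2)" for r
  proof (cases "r = 0")
    case False
    have "norm (\<alpha> r) = norm (u ^ r + v ^ r) * norm p ^ (r choose 2)"
      using False by (simp add: \<alpha>_def norm_mult norm_power)
    also have "\<dots> \<le> (norm u ^ r + norm v ^ r) * norm p ^ (r choose 2)"
      by (intro mult_right_mono order_trans[OF norm_triangle_ineq]) (auto simp: norm_power)
    finally show ?thesis by (simp add: distrib_right)
  qed (simp add: \<alpha>_def numeral_2_eq_2)
  have sumb: "summable (\<lambda>r. norm u ^ r * norm p ^ (r choose 2) + norm v ^ r * norm p ^ (r choose 2))"
    using p by (intro summable_add summable_power_choose_two) auto
  hence sum\<alpha>: "summable (\<lambda>r. norm (\<alpha> r))"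
    by (rule summable_comparison_test'[where N = 0]) (use bound in auto)
  have fin: "(\<Sum>r\<le>n. \<alpha> r / (qfact p p (n - r) * qfact p p (n + r)))
      = qfact (-u) p n * qfact (-v) p n / qfact p p (2 * n)" for n
  proof -
    define c where "c = (\<lambda>r :: int. u powi r * p powi (r * (r - 1) div 2))"
    define f where "f = (\<lambda>i. c (int n - int i) / (qfact p p i * qfact p p (2 * n - i)))"
    have choose: "int r * (int r - 1) div 2 = int (r choose 2)" for r
      by (induction r) (auto simp: choose_two_Suc algebra_simps binomial_eq_0)
    have cpos: "c (int r) = u ^ r * p ^ (r choose 2)" for r
      by (simp add: c_def choose)
    have cneg: "c (- int r) = v ^ r * p ^ (r choose 2)" for r
    proof -
      have "(- int r) * (- int r - 1) = int r * (int r - 1) + int r * 2"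
        by (simp add: algebra_simps)
      hence "(- int r) * (- int r - 1) div 2 = int (r choose 2) + int r"
        by (simp only: div_mult_self1 choose)
      hence "c (- int r) = u powi (- int r) * (p ^ (r choose 2) * p ^ r)"
        using p unfolding c_def by (simp add: power_int_add)
      also have "p ^ r = u ^ r * v ^ r" by (simp add: p_def power_mult_distrib)
      finally show ?thesis using uv by (simp add: power_int_minus)
    qed
    have "qfact (-u) p n * qfact (-v) p n / qfact p p (2 * n) = (\<Sum>i\<le>2*n. f i)"
      using finite_jacobi_triple[OF uv P, of n n]
      by (simp add: f_def c_def mult_2 flip: p_def)
    also have "\<dots> = (\<Sum>r\<le>n. if r = 0 then f n else f (n - r) + f (n + r))"
      by (rule sum_fold_even)
    also have "\<dots> = (\<Sum>r\<le>n. \<alpha> r / (qfact p p (n - r) * qfact p p (n + r)))"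
    proof (intro sum.cong refl)
      fix r assume r: "r \<in> {..n}"
      have 1: "int n - int (n - r) = int r" "2 * n - (n - r) = n + r"
        "int n - int (n + r) = - int r" "2 * n - (n + r) = n - r" using r by auto
      have "f (n - r) = u ^ r * p ^ (r choose 2) / (qfact p p (n - r) * qfact p p (n + r))"
        unfolding f_def 1 cpos ..
      moreover have "f (n + r) = v ^ r * p ^ (r choose 2) / (qfact p p (n - r) * qfact p p (n + r))"
        unfolding f_def 1 cneg by (simp add: mult.commute)
      ultimately show "(if r = 0 then f n else f (n - r) + f (n + r))
          = \<alpha> r / (qfact p p (n - r) * qfact p p (n + r))"
        by (auto simp: \<alpha>_def add_divide_distrib distrib_right numeral_2_eq_2)
    qed
    finally show ?thesis ..
  qed
  obtain K where K: "K > 0" "\<And>n. norm (inverse (qfact p p n)) \<le> K"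
    using inverse_qfact_bounded[OF p(1) p(1)] by blast
  define g where "g = (\<lambda>r n. if r \<le> n then \<alpha> r / (qfact p p (n - r) * qfact p p (n + r)) else 0)"
  have "(\<lambda>n. \<Sum>r. g r n) \<longlonglongrightarrow> (\<Sum>r. \<alpha> r / (qfact_inf p p * qfact_inf p p))"
  proof (rule tannery_sequentially[where M = "\<lambda>r. K * K * norm (\<alpha> r)"])
    fix r
    \<comment> \<open>The limit is taken along n + r, where the truncated subtraction n - r
      disappears.\<close>
    have "(\<lambda>n. \<alpha> r / (qfact p p n * qfact p p (n + (r + r)))) \<longlonglongrightarrow> \<alpha> r / (qfact_inf p p * qfact_inf p p)"
      using qfact_inf_nz[OF p(1) p(1)]
      by (intro tendsto_intros qfact_tendsto LIMSEQ_ignore_initial_segment p) auto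
    also have "(\<lambda>n. \<alpha> r / (qfact p p n * qfact p p (n + (r + r)))) = (\<lambda>n. g r (n + r))"
      by (simp add: g_def add.assoc)
    finally show "g r \<longlonglongrightarrow> \<alpha> r / (qfact_inf p p * qfact_inf p p)"
      by (rule LIMSEQ_offset)
  next
    fix r n
    have "norm (inverse (qfact p p (n - r))) * norm (inverse (qfact p p (n + r))) * norm (\<alpha> r)
        \<le> K * K * norm (\<alpha> r)"
      using K by (intro mult_mono) auto
    thus "norm (g r n) \<le> K * K * norm (\<alpha> r)"
      using K by (auto simp: g_def norm_divide norm_mult norm_inverse divide_inverse mult_ac)
  qed (intro summable_mult sum\<alpha>)
  moreover have "(\<Sum>r. g r n) = qfact (-u) p n * qfact (-v) p n / qfact p p (2 * n)" for n
  proof -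
    have "(\<Sum>r. g r n) = (\<Sum>r\<le>n. g r n)"
      by (rule suminf_finite) (auto simp: g_def)
    also have "\<dots> = (\<Sum>r\<le>n. \<alpha> r / (qfact p p (n - r) * qfact p p (n + r)))"
      by (intro sum.cong) (auto simp: g_def)
    finally show ?thesis by (simp add: fin)
  qed
  moreover have "(\<lambda>n. qfact (-u) p n * qfact (-v) p n / qfact p p (2 * n))
      \<longlonglongrightarrow> qfact_inf (-u) p * qfact_inf (-v) p / qfact_inf p p"
  proof -
    have "filterlim (\<lambda>n::nat. 2 * n) at_top at_top"
      by (rule filterlim_subseq) (auto simp: strict_mono_def)
    from filterlim_compose[OF qfact_tendsto[OF p(1)] this] show ?thesis
      using qfact_inf_nz[OF p(1) p(1)] by (intro tendsto_intros qfact_tendsto p) auto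
  qed
  ultimately have "(\<Sum>r. \<alpha> r / (qfact_inf p p * qfact_inf p p))
      = qfact_inf (-u) p * qfact_inf (-v) p / qfact_inf p p"
    by (simp add: LIMSEQ_unique)
  moreover have s: "summable \<alpha>" by (rule summable_norm_cancel[OF sum\<alpha>])
  ultimately have "suminf \<alpha> = qfact_inf (-u) p * qfact_inf (-v) p * qfact_inf p p"
    using qfact_inf_nz[OF p(1) p(1)] by (simp add: suminf_divide field_simps)
  with summable_sums[OF s] show ?thesis unfolding \<alpha>_def p_def by simp
qed

subsection \<open>Two identities of Slater\<close>

lemma qfact_inf_dissect:
  assumes p: "norm p < 1" and m: "m > 0"
  shows "qfact_inf a p = (\<Prod>j<m. qfact_inf (a * p ^ j) (p ^ m))"
proof (rule LIMSEQ_unique)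
  have fin: "qfact a p (m * n) = (\<Prod>j<m. qfact (a * p ^ j) (p ^ m) n)" for n
  proof (induction n)
    case (Suc n)
    have "qfact a p (m * Suc n) = qfact a p (m * n) * qfact (a * p ^ (m * n)) p m"
      by (simp add: qfact_add[symmetric] add.commute)
    also have "qfact (a * p ^ (m * n)) p m = (\<Prod>j<m. 1 - a * p ^ j * (p ^ m) ^ n)"
      unfolding qfact_def by (intro prod.cong) (auto simp: power_mult mult_ac)
    finally show ?case by (simp add: Suc qfact_Suc prod.distrib)
  qed simp
  have pm: "norm (p ^ m) < 1"
    using p m by (simp add: norm_power power_less_one_iff)
  have "filterlim (\<lambda>n::nat. m * n) at_top at_top"
    using m by (intro filterlim_subseq) (auto simp: strict_mono_def)
  from filterlim_compose[OF qfact_tendsto[OF p, of a] this]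
  show "(\<lambda>n. \<Prod>j<m. qfact (a * p ^ j) (p ^ m) n) \<longlonglongrightarrow> qfact_inf a p"
    unfolding fin .
  show "(\<lambda>n. \<Prod>j<m. qfact (a * p ^ j) (p ^ m) n) \<longlonglongrightarrow> (\<Prod>j<m. qfact_inf (a * p ^ j) (p ^ m))"
    by (intro tendsto_prod qfact_tendsto pm)
qed

lemma qfact_inf_mult_uminus:
  assumes p: "norm p < 1"
  shows "qfact_inf a p * qfact_inf (-a) p = qfact_inf (a^2) (p^2)"
proof (rule LIMSEQ_unique)
  have "qfact a p n * qfact (-a) p n = qfact (a^2) (p^2) n" for n
    unfolding qfact_def prod.distrib[symmetric]
    by (intro prod.cong) (simp_all add: algebra_simps power2_eq_square power_mult_distrib)
  thus "(\<lambda>n. qfact (a^2) (p^2) n) \<longlonglongrightarrow> qfact_inf a p * qfact_inf (-a) p"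
    using tendsto_mult[OF qfact_tendsto[OF p, of a] qfact_tendsto[OF p, of "-a"]] by simp
  show "(\<lambda>n. qfact (a^2) (p^2) n) \<longlonglongrightarrow> qfact_inf (a^2) (p^2)"
    using p by (intro qfact_tendsto) (simp add: norm_power power_less_one_iff)
qed

text \<open>Euler's odd-distinct partition theorem. Splitting (p;p) by parity and using (p;p)(-p;p)
  = (p^2;p^2) leaves a common nonzero factor to cancel.\<close>

lemma euler_odd_distinct:
  assumes p: "norm p < 1"
  shows "qfact_inf p (p^2) * qfact_inf (-p) p = 1"
proof -
  have p2: "norm (p^2) < 1" using p by (simp add: norm_power power_less_one_iff)
  have "{..<2} = {0, 1::nat}" by auto
  hence "qfact_inf p p = qfact_inf p (p^2) * qfact_inf (p^2) (p^2)"
    using qfact_inf_dissect[OF p, of 2 p] by (simp add: power2_eq_square)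
  with qfact_inf_mult_uminus[OF p, of p]
  have "(qfact_inf p (p^2) * qfact_inf (-p) p) * qfact_inf (p^2) (p^2) = qfact_inf (p^2) (p^2)"
    by (simp add: mult_ac)
  thus ?thesis using qfact_inf_nz[OF p2 p2] by simp
qed

text \<open>The triple product at u = 1, v = p lists every triangular power twice, and (-1;p) = 2
  (-p;p) supplies the same factor 2 on the product side.\<close>

lemma gauss_triangular:
  assumes p: "norm p < 1" "p \<noteq> 0"
  shows "(\<lambda>r. p ^ (Suc r choose 2)) sums (qfact_inf (-p) p ^ 2 * qfact_inf p p)"
proof -
  define h where "h = (\<lambda>r. p ^ (Suc r choose 2))"
  define f where "f = (\<lambda>r. if r = 0 then 1 else (1 ^ r + p ^ r) * (1 * p) ^ (r choose 2))"
  have "summable (\<lambda>r. norm p ^ r * norm p ^ (r choose 2))"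
    using p by (intro summable_power_choose_two) auto
  hence "summable h"
    by (intro summable_norm_cancel[of h]) (simp add: h_def norm_mult norm_power choose_two_Suc power_add mult.commute)
  then obtain s where s: "h sums s" by blast
  have h0: "h 0 = 1" by (simp add: h_def binomial_eq_0)
  have "f (Suc r) = h r + h (Suc r)" for r
    by (simp add: f_def h_def choose_two_Suc power_add algebra_simps)
  moreover have "(\<lambda>r. h r + h (Suc r)) sums (s + (s - 1))"
    using s h0 by (intro sums_add) (auto simp: sums_Suc_iff)
  ultimately have "f sums (s + (s - 1) + f 0)"
    by (simp flip: sums_Suc_iff)
  moreover have "f sums (qfact_inf (-1) p * qfact_inf (-p) p * qfact_inf p p)"
    using jacobi_triple_product[of 1 p] p by (simp add: f_def)
  moreover have "qfact_inf (-1) p = 2 * qfact_inf (-p) p"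
    using qfact_inf_split[OF p(1), of "-1" 1] by (simp add: qfact_Suc)
  ultimately have "2 * s = 2 * (qfact_inf (-p) p ^ 2 * qfact_inf p p)"
    using sums_unique2 by (fastforce simp: f_def power2_eq_square)
  with s show ?thesis by (simp add: h_def)
qed

section \<open>Exponent arithmetic and the two Bailey pairs\<close>

lemma two_choose_two: "2 * int (r choose 2) = int r * (int r - 1)"
  by (induction r) (auto simp: choose_two_Suc algebra_simps binomial_eq_0)

lemma square_eq_choose_two: "n ^ 2 = 2 * (n choose 2) + n"
  by (induction n) (auto simp: choose_two_Suc power2_eq_square binomial_eq_0)

text \<open>\<open>sum_triangular_powers\<close> at N = 2n: the indices n - r and n + r carry the
  triangular numbers of 2r and -2r, namely 2r^2 + r and 2r^2 - r. Writing these through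
  \<open>r choose 2\<close> avoids subtraction.\<close>

lemma bailey_pair_even:
  fixes q :: complex
  assumes q: "q \<noteq> 0" "norm q < 1"
  defines "\<alpha> \<equiv> \<lambda>r. if r = 0 then 1 else q ^ (4 * (r choose 2) + r) * (1 + q ^ (2 * r))"
  shows "1 / qfact q q (2 * n) = (\<Sum>r\<le>n. \<alpha> r / (qfact (q^2) (q^2) (n - r) * qfact (q^2) (q^2) (n + r)))"
proof -
  define c where "c = (\<lambda>d :: int. q powi (d * (d + 1) div 2))"
  define f where "f = (\<lambda>i. c (int (2 * n) - 2 * int i) / (qfact (q^2) (q^2) i * qfact (q^2) (q^2) (2 * n - i)))"
  have cpos: "c (2 * int r) = q ^ (4 * (r choose 2) + 3 * r)" for r
  proof -
    have "(2 * int r) * (2 * int r + 1) = int (4 * (r choose 2) + 3 * r) * 2"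
      using two_choose_two[of r] by (simp add: algebra_simps)
    thus ?thesis unfolding c_def by (simp only: nonzero_mult_div_cancel_right power_int_of_nat zero_neq_numeral not_False_eq_True)
  qed
  have cneg: "c (- 2 * int r) = q ^ (4 * (r choose 2) + r)" for r
  proof -
    have "(- 2 * int r) * (- 2 * int r + 1) = int (4 * (r choose 2) + r) * 2"
      using two_choose_two[of r] by (simp add: algebra_simps)
    thus ?thesis unfolding c_def by (simp only: nonzero_mult_div_cancel_right power_int_of_nat zero_neq_numeral not_False_eq_True)
  qed
  have "1 / qfact q q (2 * n) = (\<Sum>i\<le>2*n. f i)"
    using sum_triangular_powers[OF q, of "2 * n"] by (simp add: f_def c_def)
  also have "\<dots> = (\<Sum>r\<le>n. if r = 0 then f n else f (n - r) + f (n + r))"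
    by (rule sum_fold_even)
  also have "\<dots> = (\<Sum>r\<le>n. \<alpha> r / (qfact (q^2) (q^2) (n - r) * qfact (q^2) (q^2) (n + r)))"
  proof (intro sum.cong refl)
    fix r assume r: "r \<in> {..n}"
    have 1: "int (2 * n) - 2 * int (n - r) = 2 * int r" "2 * n - (n - r) = n + r"
      "int (2 * n) - 2 * int (n + r) = - 2 * int r" "2 * n - (n + r) = n - r" using r by auto
    have "f (n - r) = q ^ (4 * (r choose 2) + 3 * r) / (qfact (q^2) (q^2) (n - r) * qfact (q^2) (q^2) (n + r))"
      unfolding f_def 1 cpos ..
    moreover have "f (n + r) = q ^ (4 * (r choose 2) + r) / (qfact (q^2) (q^2) (n - r) * qfact (q^2) (q^2) (n + r))"
      unfolding f_def 1 cneg by (simp add: mult.commute)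
    moreover have "q ^ (4 * (r choose 2) + 3 * r) = q ^ (4 * (r choose 2) + r) * q ^ (2 * r)"
      unfolding power_add[symmetric] by (rule arg_cong[where f = "(^) q"]) simp
    ultimately show "(if r = 0 then f n else f (n - r) + f (n + r))
        = \<alpha> r / (qfact (q^2) (q^2) (n - r) * qfact (q^2) (q^2) (n + r))"
      by (auto simp: \<alpha>_def add_divide_distrib distrib_left binomial_eq_0)
  qed
  finally show ?thesis .
qed

text \<open>\<open>sum_triangular_powers\<close> at N = 2n+1, with triangular numbers of 2r+1 and
  -2r-1. The division by 1 - q^2 comes from (q^2;q^2)_(n+r+1) = (1 - q^2) (q^4;q^2)_(n+r).\<close>

lemma bailey_pair_odd:
  fixes q :: complex
  assumes q: "q \<noteq> 0" "norm q < 1"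
  defines "\<alpha> \<equiv> \<lambda>r. q ^ (4 * (r choose 2) + 3 * r) * (1 + q ^ (2 * r + 1)) / (1 - q^2)"
  shows "1 / qfact q q (2 * n + 1) = (\<Sum>r\<le>n. \<alpha> r / (qfact (q^2) (q^2) (n - r) * qfact (q^4) (q^2) (n + r)))"
proof -
  define c where "c = (\<lambda>d :: int. q powi (d * (d + 1) div 2))"
  define N where "N = 2 * n + 1"
  define f where "f = (\<lambda>i. c (int N - 2 * int i) / (qfact (q^2) (q^2) i * qfact (q^2) (q^2) (N - i)))"
  have cpos: "c (2 * int r + 1) = q ^ (4 * (r choose 2) + 3 * r) * q ^ (2 * r + 1)" for r
  proof -
    have "(2 * int r + 1) * (2 * int r + 1 + 1) = int ((4 * (r choose 2) + 3 * r) + (2 * r + 1)) * 2"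
      using two_choose_two[of r] by (simp add: algebra_simps)
    thus ?thesis unfolding c_def power_add[symmetric] by (simp only: nonzero_mult_div_cancel_right power_int_of_nat zero_neq_numeral not_False_eq_True)
  qed
  have cneg: "c (- 2 * int r - 1) = q ^ (4 * (r choose 2) + 3 * r)" for r
  proof -
    have "(- 2 * int r - 1) * (- 2 * int r - 1 + 1) = int (4 * (r choose 2) + 3 * r) * 2"
      using two_choose_two[of r] by (simp add: algebra_simps)
    thus ?thesis unfolding c_def by (simp only: nonzero_mult_div_cancel_right power_int_of_nat zero_neq_numeral not_False_eq_True)
  qed
  have "1 / qfact q q N = (\<Sum>i\<le>2*n+1. f i)"
    using sum_triangular_powers[OF q, of N] by (simp add: f_def c_def N_def del: sum.atMost_Suc)
  also have "\<dots> = (\<Sum>r\<le>n. f (n - r) + f (n + r + 1))"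
    by (rule sum_fold_odd)
  also have "\<dots> = (\<Sum>r\<le>n. \<alpha> r / (qfact (q^2) (q^2) (n - r) * qfact (q^4) (q^2) (n + r)))"
  proof (intro sum.cong refl)
    fix r assume r: "r \<in> {..n}"
    have 1: "int N - 2 * int (n - r) = 2 * int r + 1" "N - (n - r) = n + r + 1"
      "int N - 2 * int (n + r + 1) = - 2 * int r - 1" "N - (n + r + 1) = n - r" using r by (auto simp: N_def)
    have 2: "qfact (q^2) (q^2) (n + r + 1) = (1 - q^2) * qfact (q^4) (q^2) (n + r)"
      using qfact_add[of "q^2" "q^2" 1 "n + r"] by (simp add: qfact_Suc flip: power_add)
    have "f (n - r) = q ^ (4 * (r choose 2) + 3 * r) * q ^ (2 * r + 1)
        / (qfact (q^2) (q^2) (n - r) * ((1 - q^2) * qfact (q^4) (q^2) (n + r)))"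
      unfolding f_def 1 2 cpos ..
    moreover have "f (n + r + 1) = q ^ (4 * (r choose 2) + 3 * r)
        / (qfact (q^2) (q^2) (n - r) * ((1 - q^2) * qfact (q^4) (q^2) (n + r)))"
      unfolding f_def 1 cneg 2 by (simp only: mult_ac)
    moreover have "A * B / (X * (D * Y)) + A / (X * (D * Y)) = A * (1 + B) / D / (X * Y)"
      for A B X D Y :: complex
      by (simp add: divide_inverse algebra_simps)
    ultimately show "f (n - r) + f (n + r + 1)
        = \<alpha> r / (qfact (q^2) (q^2) (n - r) * qfact (q^4) (q^2) (n + r))"
      unfolding \<alpha>_def by (simp only:)
  qed
  finally show ?thesis by (simp add: N_def)
qed

lemma norm_power_lt_one:
  fixes q :: complex
  shows "norm q < 1 \<Longrightarrow> n > 0 \<Longrightarrow> norm (q ^ n) < 1"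
  by (simp add: norm_power power_less_one_iff)

text \<open>The series left by Bailey's lemma has terms q^(3r^2-r) (1 + q^(2r)) for r > 0, the
  triple product with u = q^2 and v = q^4.\<close>

theorem slater_29:
  fixes q :: complex
  assumes q: "q \<noteq> 0" "norm q < 1"
  shows "(\<lambda>n. qfact (-q) (q^2) n * q ^ (n^2) / qfact q q (2*n)) sums
    (qfacts_inf [-(q^2), -(q^4), q^6] (q^6) * qfact_inf (-q) (q^2) / qfact_inf (q^2) (q^2))"
proof -
  define \<alpha> where "\<alpha> = (\<lambda>r. if r = 0 then 1 else q ^ (4 * (r choose 2) + r) * (1 + q ^ (2 * r)))"
  have q2: "norm (q^2) < 1" using q by (simp add: norm_power_lt_one)
  have "summable (\<lambda>r. 2 * norm q ^ r)"
    using q by (intro summable_mult summable_geometric) auto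
  moreover have "norm (\<alpha> r) \<le> 2 * norm q ^ r" for r
  proof (cases "r = 0")
    case False
    have "norm (1 + q ^ (2 * r)) \<le> norm (1::complex) + norm (q ^ (2 * r))"
      by (rule norm_triangle_ineq)
    also have "\<dots> \<le> 2" using q by (simp add: norm_power power_le_one)
    finally have "norm (1 + q ^ (2 * r)) * norm q ^ (4 * (r choose 2) + r) \<le> 2 * norm q ^ r"
      using q by (intro mult_mono power_decreasing) auto
    thus ?thesis using False by (simp add: \<alpha>_def norm_mult norm_power mult.commute)
  qed (simp add: \<alpha>_def)
  ultimately have sum\<alpha>: "summable (\<lambda>r. norm (\<alpha> r))"
    by - (rule summable_comparison_test'[where N = 0 and g = "\<lambda>r. 2 * norm q ^ r"], auto)
  have exp: "(- (- q)) ^ r * (q^2) ^ (r choose 2) = q ^ (r^2)" for r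
    unfolding square_eq_choose_two minus_minus power_mult[symmetric] power_add[symmetric]
    by (rule arg_cong[where f = "(^) q"]) simp
  have a: "(-q) * (-q) = q^2" by (simp add: power2_eq_square)
  have main: "(\<lambda>n. qfact (-q) (q^2) n * (- (- q)) ^ n * (q^2) ^ (n choose 2) * (1 / qfact q q (2 * n))) sums
      (qfact_inf (-q) (q^2) / qfact_inf (q^2) (q^2) *
        (\<Sum>r. qfact (-q) (q^2) r * (- (- q)) ^ r * (q^2) ^ (r choose 2) / qfact (-q) (q^2) r * \<alpha> r))"
    by (rule bailey_lemma[of "q^2" "-q" "-q" \<alpha> "\<lambda>n. 1 / qfact q q (2 * n)", unfolded a])
       (use q q2 sum\<alpha> bailey_pair_even[OF q] in \<open>simp_all add: \<alpha>_def\<close>)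
  have summand: "qfact (-q) (q^2) r * (- (- q)) ^ r * (q^2) ^ (r choose 2) / qfact (-q) (q^2) r * \<alpha> r
      = (if r = 0 then 1 else ((q^2) ^ r + (q^4) ^ r) * (q^2 * q^4) ^ (r choose 2))" for r
  proof -
    have "qfact (-q) (q^2) r * (- (- q)) ^ r * (q^2) ^ (r choose 2) / qfact (-q) (q^2) r * \<alpha> r = q ^ (r^2) * \<alpha> r"
      using qfact_nz[of "-q" "q^2" r] q q2 exp[of r] by (simp add: mult.assoc)
    also have "\<dots> = (if r = 0 then 1 else ((q^2) ^ r + (q^4) ^ r) * (q^2 * q^4) ^ (r choose 2))"
    proof -
      have "q ^ (r^2) * q ^ (4 * (r choose 2) + r) = q ^ (2 * r) * q ^ (6 * (r choose 2))"
        unfolding square_eq_choose_two power_add[symmetric] by (rule arg_cong[where f = "(^) q"]) simp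
      moreover have "q ^ (4 * r) = q ^ (2 * r) * q ^ (2 * r)"
        unfolding power_add[symmetric] by simp
      moreover have "q^2 * q^4 = q^6" unfolding power_add[symmetric] by simp
      ultimately show ?thesis
        by (simp add: \<alpha>_def algebra_simps flip: power_mult)
    qed
    finally show ?thesis .
  qed
  have u: "q^2 * q^4 = q^6" unfolding power_add[symmetric] by simp
  have J: "(\<Sum>r. if r = 0 then 1 else ((q^2) ^ r + (q^4) ^ r) * (q^2 * q^4) ^ (r choose 2))
      = qfacts_inf [-(q^2), -(q^4), q^6] (q^6)"
    using sums_unique[OF jacobi_triple_product[of "q^2" "q^4"]] q
    by (simp add: u norm_power_lt_one qfacts_inf_def mult.assoc)
  have lhs: "qfact (-q) (q^2) n * (- (- q)) ^ n * (q^2) ^ (n choose 2) * (1 / qfact q q (2 * n))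
      = qfact (-q) (q^2) n * q ^ (n^2) / qfact q q (2*n)" for n
    unfolding exp[symmetric] by simp
  show ?thesis
    using main unfolding lhs summand J by (simp only: times_divide_eq_left mult.commute)
qed

text \<open>The exponents r^2 + 2r and 2r^2 + r add up to six times a triangular number, so Gauss's
  series in q^6 appears.\<close>

theorem slater_50:
  fixes q :: complex
  assumes q: "q \<noteq> 0" "norm q < 1"
  shows "(\<lambda>n. qfact (-q) (q^2) n * q ^ (n^2 + 2*n) / qfact q q (2*n + 1)) sums
    (qfacts_inf [q^2, q^10, q^12] (q^12) / qfact_inf q q)"
proof -
  define \<alpha> where "\<alpha> = (\<lambda>r. q ^ (4 * (r choose 2) + 3 * r) * (1 + q ^ (2 * r + 1)) / (1 - q^2))"
  have small: "norm (q ^ n) < 1" if "n > 0" for n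
    using q(2) that by (rule norm_power_lt_one)
  have nz1: "1 - q^2 \<noteq> 0" "1 + q \<noteq> 0"
    using qfact_factor_nz[of "q^2" "q^2" 0] qfact_factor_nz[of "-q" "q^2" 0] small[of 2] q by auto
  have "summable (\<lambda>r. 2 / norm (1 - q^2) * norm q ^ r)"
    using q by (intro summable_mult summable_geometric) auto
  moreover have "norm (\<alpha> r) \<le> 2 / norm (1 - q^2) * norm q ^ r" for r
  proof -
    have "norm (1 + q ^ (2 * r + 1)) \<le> norm (1::complex) + norm (q ^ (2 * r + 1))"
      by (rule norm_triangle_ineq)
    also have "\<dots> \<le> 2" using small[of "2 * r + 1"] by simp
    finally have "norm (1 + q ^ (2 * r + 1)) * norm q ^ (4 * (r choose 2) + 3 * r) \<le> 2 * norm q ^ r"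
      using q by (intro mult_mono power_decreasing) auto
    hence "norm (1 + q ^ (2 * r + 1)) * norm q ^ (4 * (r choose 2) + 3 * r) / norm (1 - q^2)
        \<le> 2 * norm q ^ r / norm (1 - q^2)"
      by (rule divide_right_mono) simp
    thus ?thesis by (simp add: \<alpha>_def norm_mult norm_power norm_divide mult.commute)
  qed
  ultimately have sum\<alpha>: "summable (\<lambda>r. norm (\<alpha> r))"
    by - (rule summable_comparison_test'[where N = 0 and g = "\<lambda>r. 2 / norm (1 - q^2) * norm q ^ r"], auto)
  have exp: "(- (- (q^3))) ^ r * (q^2) ^ (r choose 2) = q ^ (r^2 + 2 * r)" for r
    unfolding square_eq_choose_two minus_minus power_mult[symmetric] power_add[symmetric]
    by (rule arg_cong[where f = "(^) q"]) simp
  have q4: "(-q) * (- (q^3)) = q^4"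
    by (simp add: power_numeral_reduce)
  have main: "(\<lambda>n. qfact (-q) (q^2) n * (- (- (q^3))) ^ n * (q^2) ^ (n choose 2) * (1 / qfact q q (2 * n + 1))) sums
      (qfact_inf (- (q^3)) (q^2) / qfact_inf (q^4) (q^2) *
        (\<Sum>r. qfact (-q) (q^2) r * (- (- (q^3))) ^ r * (q^2) ^ (r choose 2) / qfact (- (q^3)) (q^2) r * \<alpha> r))"
    by (rule bailey_lemma[of "q^2" "- (q^3)" "-q" \<alpha> "\<lambda>n. 1 / qfact q q (2 * n + 1)", unfolded q4])
       (use small sum\<alpha> bailey_pair_odd[OF q] in \<open>simp_all add: \<alpha>_def\<close>)
  have summand: "qfact (-q) (q^2) r * (- (- (q^3))) ^ r * (q^2) ^ (r choose 2) / qfact (- (q^3)) (q^2) r * \<alpha> r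
      = (1 + q) / (1 - q^2) * (q^6) ^ (Suc r choose 2)" for r
  proof -
    have "qfact (-q) (q^2) (Suc r) = (1 + q) * qfact (- (q^3)) (q^2) r"
      using qfact_add[of "-q" "q^2" 1 r] by (simp add: qfact_Suc power_numeral_reduce)
    hence 1: "qfact (-q) (q^2) r * (1 + q ^ (2 * r + 1)) = (1 + q) * qfact (- (q^3)) (q^2) r"
      by (simp add: qfact_Suc power_mult)
    have 2: "q ^ (r^2 + 2 * r) * q ^ (4 * (r choose 2) + 3 * r) = (q^6) ^ (Suc r choose 2)"
      unfolding square_eq_choose_two choose_two_Suc power_mult[symmetric] power_add[symmetric]
      by (rule arg_cong[where f = "(^) q"]) simp
    have 3: "qfact (- (q^3)) (q^2) r \<noteq> 0"
      using small[of 3] small[of 2] by (intro qfact_nz) auto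
    have "qfact (-q) (q^2) r * (- (- (q^3))) ^ r * (q^2) ^ (r choose 2) / qfact (- (q^3)) (q^2) r * \<alpha> r
      = (qfact (-q) (q^2) r * (1 + q ^ (2 * r + 1))) / qfact (- (q^3)) (q^2) r
        * (((- (- (q^3))) ^ r * (q^2) ^ (r choose 2)) * q ^ (4 * (r choose 2) + 3 * r)) / (1 - q^2)"
      by (simp add: \<alpha>_def mult_ac)
    also have "\<dots> = (1 + q) / (1 - q^2) * (q^6) ^ (Suc r choose 2)"
      unfolding exp 1 2 using 3 by simp
    finally show ?thesis .
  qed
  define G where "G = qfact_inf (- (q^6)) (q^6) ^ 2 * qfact_inf (q^6) (q^6)"
  have "(\<lambda>r. (1 + q) / (1 - q^2) * (q^6) ^ (Suc r choose 2)) sums ((1 + q) / (1 - q^2) * G)"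
    unfolding G_def using q small by (intro sums_mult gauss_triangular) auto
  hence G: "(\<Sum>r. (1 + q) / (1 - q^2) * (q^6) ^ (Suc r choose 2)) = (1 + q) / (1 - q^2) * G"
    by (rule sums_unique[symmetric])
  have "qfact (-q) (q^2) n * (- (- (q^3))) ^ n * (q^2) ^ (n choose 2) * (1 / qfact q q (2 * n + 1))
      = qfact (-q) (q^2) n * q ^ (n^2 + 2*n) / qfact q q (2*n + 1)" for n
    unfolding exp[symmetric] by simp
  with main have "(\<lambda>n. qfact (-q) (q^2) n * q ^ (n^2 + 2*n) / qfact q q (2*n + 1)) sums
      (qfact_inf (- (q^3)) (q^2) / qfact_inf (q^4) (q^2) * ((1 + q) / (1 - q^2) * G))"
    unfolding summand G by (simp only:)
  \<comment> \<open>The stray factors 1 + q and 1 - q^2 are the first factors of (-q;q^2) and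
    (q^2;q^2).\<close>
  also have "qfact_inf (- (q^3)) (q^2) / qfact_inf (q^4) (q^2) * ((1 + q) / (1 - q^2) * G)
      = qfact_inf (-q) (q^2) / qfact_inf (q^2) (q^2) * G"
  proof -
    have "qfact_inf (-q) (q^2) = (1 + q) * qfact_inf (- (q^3)) (q^2)"
      using qfact_inf_split[of "q^2" "-q" 1] small[of 2] by (simp add: qfact_Suc power_numeral_reduce)
    moreover have "qfact_inf (q^2) (q^2) = (1 - q^2) * qfact_inf (q^4) (q^2)"
      using qfact_inf_split[of "q^2" "q^2" 1] small by (simp add: qfact_Suc flip: power_add)
    ultimately show ?thesis by (simp add: mult_ac)
  qed
  \<comment> \<open>After multiplication by (q;q^2), the product (q;q^2)(-q;q^2) = (q^2;q^4) splits
    into the classes 2, 6, 10 modulo 12. Euler's identity cancels class 6 against one factor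
    (-q^6;q^6); the other merges with (q^6;q^6) into (q^12;q^12).\<close>
  also have "\<dots> = qfacts_inf [q^2, q^10, q^12] (q^12) / qfact_inf q q"
  proof -
    have s2: "{..<2} = {0, 1::nat}" and s3: "{..<3} = {0, 1, 2::nat}" by auto
    have 1: "qfact_inf q q = qfact_inf q (q^2) * qfact_inf (q^2) (q^2)"
      using qfact_inf_dissect[OF q(2), of 2 q] by (simp add: s2 power2_eq_square)
    have 2: "qfact_inf q (q^2) * qfact_inf (-q) (q^2) = qfact_inf (q^2) (q^4)"
      using qfact_inf_mult_uminus[of "q^2" q] small by simp
    have 3: "qfact_inf (q^2) (q^4) = qfact_inf (q^2) (q^12) * qfact_inf (q^6) (q^12) * qfact_inf (q^10) (q^12)"
    proof -
      have "q^2 * q^4 = q^6" "q^2 * (q^4)^2 = q^10" "(q^4)^3 = q^12"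
        unfolding power_mult[symmetric] power_add[symmetric] by simp_all
      thus ?thesis
        using qfact_inf_dissect[of "q^4" 3 "q^2"] small[of 4] by (simp add: s3 mult.assoc)
    qed
    have 4: "qfact_inf (q^6) (q^12) * qfact_inf (- (q^6)) (q^6) = 1"
      using euler_odd_distinct[of "q^6"] small by simp
    have 5: "qfact_inf (q^6) (q^6) * qfact_inf (- (q^6)) (q^6) = qfact_inf (q^12) (q^12)"
      using qfact_inf_mult_uminus[of "q^6" "q^6"] small by simp
    have nz: "qfact_inf q (q^2) \<noteq> 0" "qfact_inf (q^2) (q^2) \<noteq> 0"
      using q(2) small[of 2] by (simp_all add: qfact_inf_nz)
    have "qfact_inf (-q) (q^2) * qfact_inf q (q^2) * G
      = qfact_inf (q^2) (q^12) * qfact_inf (q^10) (q^12)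
        * (qfact_inf (q^6) (q^12) * qfact_inf (- (q^6)) (q^6))
        * (qfact_inf (q^6) (q^6) * qfact_inf (- (q^6)) (q^6))"
      using 2 3 by (simp add: G_def power2_eq_square mult_ac)
    also have "\<dots> = qfacts_inf [q^2, q^10, q^12] (q^12)"
      unfolding 4 5 by (simp add: qfacts_inf_def mult_ac)
    finally show ?thesis
      unfolding 1 using nz by (simp add: field_simps)
  qed
  finally show ?thesis .
qed


subsection \<open>The recurrences in \<open>m\<close>\<close>

lemma three_term_recurrence_unique:
  fixes F G :: "nat \<Rightarrow> 'a :: semiring_0"
  assumes "F 0 = G 0" "F 1 = G 1"
    and "\<And>k. F (k + 2) = x k * F (k + 1) + y k * F k"
    and "\<And>k. G (k + 2) = x k * G (k + 1) + y k * G k"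
  shows "F k = G k"
  using assms by (induction k rule: induct_nat_012) auto

theorem theorem2p3:
  fixes q :: complex and P Q A B :: "nat \<Rightarrow> complex"
  assumes q: "0 < norm q" "norm q < 1"
    and P: "P 0 = 1" "P 1 = 1 + q"
      "\<forall>m\<ge>2. P m = (1 + q + q ^ (2*m - 1)) * P (m - 1) + (q ^ (2*m - 2) - q) * P (m - 2)"
    and Q: "Q 0 = 0" "Q 1 = 1"
      "\<forall>m\<ge>2. Q m = (1 + q + q ^ (2*m - 1)) * Q (m - 1) + (q ^ (2*m - 2) - q) * Q (m - 2)"
    and A: "A 0 = 1" "A 1 = 1"
      "\<forall>m\<ge>2. A m = (1 + q + q ^ (2*m - 2)) * A (m - 1) + (q ^ (2*m - 2) - q) * A (m - 2)"
    and B: "B 0 = 0" "B 1 = 2 * q"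
      "\<forall>m\<ge>2. B m = (1 + q + q ^ (2*m - 2)) * B (m - 1) + (q ^ (2*m - 2) - q) * B (m - 2)"
  shows "(\<forall>m\<ge>1.
      (\<lambda>n. qfact (-q) (q^2) n * q ^ (n^2 + 2*m*n) / qfact q q (2*n + 1)) sums
        (q powi (1 - int m) * qfacts_inf [q^2, q^10, q^12] (q^12)
            / (qfact q (q^2) (m - 1) * qfact_inf q q) * P (m - 1)
         - q powi (1 - int m) * qfacts_inf [-(q^2), -(q^4), q^6] (q^6) * qfact_inf (-q) (q^2)
            / (qfact q (q^2) (m - 1) * qfact_inf (q^2) (q^2)) * Q (m - 1)))
    \<and> (\<forall>m.
      (\<lambda>n. qfact (-q) (q^2) n * q ^ (n^2 + 2*m*n) / qfact q q (2*n)) sums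
        (qfacts_inf [-(q^2), -(q^4), q^6] (q^6) * qfact_inf (-q) (q^2)
            / (qfact q (q^2) m * qfact_inf (q^2) (q^2)) * A m
         - qfacts_inf [q^2, q^10, q^12] (q^12)
            / (qfact q (q^2) m * qfact_inf q q) * B m))"
proof -
  have q0: "q \<noteq> 0" using q by auto
  have nz: "1 - q * q ^ n \<noteq> 0" for n
    using q by (intro qfact_factor_nz) auto
  have qnz: "qfact q q n \<noteq> 0" for n
    using q by (intro qfact_nz) auto
  define a where "a = (\<lambda>m n. qfact (-q) (q^2) n * q ^ (n^2 + 2*m*n))"
  define s where "s = (\<lambda>m n. a m n / qfact q q (2*n + 1))"
  define t where "t = (\<lambda>m n. a m n / qfact q q (2*n))"
  have a_Suc: "a (Suc m) n = a m n * q ^ (2 * n)" for m n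
    by (simp add: a_def mult.assoc flip: power_add) (simp add: algebra_simps)
  have t_eq: "s m n * (1 - q ^ (2 * n + 1)) = t m n" for m n
    using nz[of "2 * n"] by (simp add: s_def t_def qfact_Suc)
  \<comment> \<open>An arbitrary length \<open>f\<close> covers both denominators at once, since
    1/(q;q)_n is bounded.\<close>
  have sum_a: "summable (\<lambda>n. a m n / qfact q q (f n))" for m and f :: "nat \<Rightarrow> nat"
  proof -
    obtain K1 where K1: "K1 > 0" "\<And>n. norm (qfact (-q) (q^2) n) \<le> K1"
      using qfact_bounded[of "q^2"] q by (metis norm_power_lt_one zero_less_numeral)
    obtain K2 where K2: "K2 > 0" "\<And>n. norm (inverse (qfact q q n)) \<le> K2"
      using inverse_qfact_bounded q by blast
    have "summable (\<lambda>n. K1 * K2 * norm q ^ n)"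
      using q by (intro summable_mult summable_geometric) auto
    moreover have "norm (a m n / qfact q q (f n)) \<le> K1 * K2 * norm q ^ n" for n
    proof -
      have "n \<le> n^2 + 2*m*n"
        unfolding square_eq_choose_two by simp
      hence "norm (qfact (-q) (q^2) n) * norm (inverse (qfact q q (f n))) * norm q ^ (n^2 + 2*m*n)
          \<le> K1 * K2 * norm q ^ n"
        using q K1 K2 by (intro mult_mono power_decreasing) auto
      thus ?thesis
        by (simp add: a_def norm_mult norm_divide norm_inverse norm_power divide_inverse mult_ac)
    qed
    ultimately show ?thesis
      by - (rule summable_comparison_test'[where N = 0 and g = "\<lambda>n. K1 * K2 * norm q ^ n"], auto)
  qed
  have sum_s: "summable (s m)" and sum_t: "summable (t m)" for m
    unfolding s_def t_def by (rule sum_a)+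
  \<comment> \<open>The factor 1 - q^(2n+1) is the last one of (q;q)_(2n+1), and q^(2n) raises m by
    one.\<close>
  have s_Suc: "s m n = t m n + q * s (Suc m) n" for m n
  proof -
    have "s (Suc m) n = s m n * q ^ (2 * n)"
      by (simp add: s_def a_Suc)
    with t_eq[of m n] show ?thesis by (simp add: algebra_simps)
  qed
  have t_0: "t m 0 = t (Suc m) 0" for m
    by (simp add: t_def a_def)
  \<comment> \<open>Here 1 - q^(2n+2) cancels the last factor of (q;q)_(2n+2), and the new factor 1
    + q^(2n+1) of (-q;q^2)_(n+1) creates the two terms on the right. The index shift is harmless
    because the terms at 0 agree.\<close>
  have t_diff: "t m (Suc n) - t (Suc m) (Suc n)
      = q ^ (2 * m + 1) * (s (Suc m) n + q * s (Suc (Suc m)) n)" for m n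
  proof -
    have sq: "(Suc n)^2 + 2 * m * Suc n = (2 * m + 1) + (n^2 + 2 * m * n + 2 * n)"
      by (simp add: power2_eq_square algebra_simps)
    have "a m (Suc n) = q ^ (2 * m + 1) * (a (Suc m) n * (1 + q ^ (2 * n + 1)))"
      unfolding a_Suc unfolding a_def sq by (simp add: qfact_Suc power_add mult_ac flip: power_mult)
    moreover have "t m (Suc n) - t (Suc m) (Suc n) = a m (Suc n) / qfact q q (2 * n + 1)"
    proof -
      have E: "qfact q q (2 * Suc n) = qfact q q (2 * n + 1) * (1 - q ^ (2 * Suc n))"
        using qfact_Suc[of q q "2 * n + 1"] by simp
      have "1 - q ^ (2 * Suc n) \<noteq> 0" using nz[of "2 * n + 1"] by simp
      moreover have "x / (y * (1 - z)) - x * z / (y * (1 - z)) = x / y" if "1 - z \<noteq> 0" for x y z :: complex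
      proof -
        have "x / (y * (1 - z)) - x * z / (y * (1 - z)) = x * (1 - z) / (y * (1 - z))"
          by (simp add: right_diff_distrib diff_divide_distrib)
        thus ?thesis using that by simp
      qed
      ultimately show ?thesis
        unfolding t_def a_Suc E by blast
    qed
    ultimately have "t m (Suc n) - t (Suc m) (Suc n) = q ^ (2 * m + 1) * (s (Suc m) n * (1 + q ^ (2 * n + 1)))"
      unfolding s_def by (simp only: times_divide_eq_left times_divide_eq_right)
    moreover have "s (Suc (Suc m)) n = s (Suc m) n * q ^ (2 * n)"
      unfolding s_def a_Suc[of "Suc m"] by simp
    ultimately show ?thesis
      by (simp only: power_add power_one_right distrib_left mult_1_right mult_1_left mult_ac)
  qed
  define S where "S = (\<lambda>m. suminf (s m))"
  define T where "T = (\<lambda>m. suminf (t m))"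
  have ST: "S m = T m + q * S (Suc m)" for m
  proof -
    have "S m = (\<Sum>n. t m n + q * s (Suc m) n)"
      unfolding S_def by (rule suminf_cong) (rule s_Suc)
    also have "\<dots> = T m + q * S (Suc m)"
      unfolding S_def T_def by (simp add: suminf_add[symmetric] suminf_mult sum_s sum_t summable_mult)
    finally show ?thesis .
  qed
  have TT: "T m - T (Suc m) = q ^ (2 * m + 1) * (S (Suc m) + q * S (Suc (Suc m)))" for m
  proof -
    have "T m - T (Suc m) = (\<Sum>n. t m (Suc n)) - (\<Sum>n. t (Suc m) (Suc n))"
      unfolding T_def using suminf_split_head[OF sum_t, of m] suminf_split_head[OF sum_t, of "Suc m"] t_0[of m]
      by simp
    also have "\<dots> = (\<Sum>n. t m (Suc n) - t (Suc m) (Suc n))"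
      by (intro suminf_diff) (simp_all add: sum_t summable_Suc_iff)
    also have "\<dots> = q ^ (2 * m + 1) * (S (Suc m) + q * S (Suc (Suc m)))"
      unfolding t_diff S_def
      by (simp add: suminf_mult suminf_add[symmetric] sum_s summable_mult summable_add del: power_Suc)
    finally show ?thesis .
  qed
  have rec_S: "q * (1 - q ^ (2 * m + 1)) * S (m + 2) = (1 + q + q ^ (2 * m + 1)) * S (m + 1) - S m" for m
    using TT[of m] ST[of m] ST[of "Suc m"] by (simp add: algebra_simps)
  \<comment> \<open>Replacing q S(m+2) by S(m+1) - T(m+1) doubles S(m+1); this is the origin of the
    2 in B_1 = 2q.\<close>
  have rec_S': "2 * q ^ (2 * m + 1) * S (m + 1) = T m - (1 - q ^ (2 * m + 1)) * T (m + 1)" for m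
    using TT[of m] ST[of "Suc m"] by (simp add: algebra_simps)
  \<comment> \<open>Two consecutive instances of \<open>rec_S'\<close> are combined so that S(m+1) -
    q S(m+2) appears, which is T(m+1).\<close>
  have rec_T: "(1 - q ^ (2 * m + 3)) * T (m + 2) = (1 + q + q ^ (2 * m + 2)) * T (m + 1) - q * T m" for m
  proof -
    have "q ^ (2 * m + 3) = q ^ (2 * m + 1) * q^2" by (simp add: power_add power_numeral_reduce)
    hence "q * (2 * q ^ (2 * m + 1) * S (m + 1)) - 2 * q ^ (2 * Suc m + 1) * S (Suc m + 1)
        = 2 * q ^ (2 * m + 2) * T (m + 1)"
      using ST[of "Suc m"] by (simp add: algebra_simps power2_eq_square)
    thus ?thesis
      unfolding rec_S' by (simp add: algebra_simps power_add power3_eq_cube power2_eq_square)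
  qed
  define X where "X = qfacts_inf [q^2, q^10, q^12] (q^12) / qfact_inf q q"
  define Y where "Y = qfacts_inf [-(q^2), -(q^4), q^6] (q^6) * qfact_inf (-q) (q^2) / qfact_inf (q^2) (q^2)"
  have T0: "T 0 = Y"
    using slater_29[OF q0 q(2)] by (simp add: T_def t_def a_def Y_def sums_iff)
  have S1: "S 1 = X"
    using slater_50[OF q0 q(2)] by (simp add: S_def s_def a_def X_def sums_iff)
  have qf: "qfact q (q^2) (Suc k) = qfact q (q^2) k * (1 - q ^ (2 * k + 1))" for k
    by (simp add: qfact_Suc power_mult)
  have qfnz: "qfact q (q^2) k \<noteq> 0" for k
    using q by (intro qfact_nz) (auto simp: norm_power power_le_one)
  \<comment> \<open>The multiplier q^k (q;q^2)_k absorbs the leading coefficient q (1 - q^(2k+3)) of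
    the recurrence; two steps further down it leaves -q (1 - q^(2k+1)), the coefficient q^(2k+2) - q
    of \<open>P\<close> and \<open>Q\<close>.\<close>
  have S_closed: "S (k + 1) * (q ^ k * qfact q (q^2) k) = X * P k - Y * Q k" for k
  proof (rule three_term_recurrence_unique)
    show "S (0 + 1) * (q ^ 0 * qfact q (q^2) 0) = X * P 0 - Y * Q 0"
      using S1 P Q by simp
    \<comment> \<open>The value S_0 = Y + q X enters here and produces P_1 = 1 + q and Q_1 =
      1.\<close>
    have "q * (1 - q) * S 2 = (1 + q) * X - Y"
      using rec_S[of 0] ST[of 0] S1 T0 by (simp add: algebra_simps numeral_2_eq_2)
    thus "S (1 + 1) * (q ^ 1 * qfact q (q^2) 1) = X * P 1 - Y * Q 1"
      using P(2) Q(2) by (simp add: qfact_Suc mult_ac numeral_2_eq_2)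
    fix k
    have "S (k + 2 + 1) * (q ^ (k + 2) * qfact q (q^2) (k + 2))
        = (q * (1 - q ^ (2 * (k + 1) + 1)) * S (k + 1 + 2)) * (q ^ (k + 1) * qfact q (q^2) (k + 1))"
      using qf[of "k + 1"] by (simp add: mult_ac)
    also have "\<dots> = (1 + q + q ^ (2 * k + 3)) * (S (k + 1 + 1) * (q ^ (k + 1) * qfact q (q^2) (k + 1)))
        - S (k + 1) * (q ^ (k + 1) * qfact q (q^2) (k + 1))"
      unfolding rec_S by (simp add: algebra_simps power_add power3_eq_cube power2_eq_square)
    also have "S (k + 1) * (q ^ (k + 1) * qfact q (q^2) (k + 1))
        = q * (1 - q ^ (2 * k + 1)) * (S (k + 1) * (q ^ k * qfact q (q^2) k))"
      using qf[of k] by (simp add: mult_ac)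
    finally show "S (k + 2 + 1) * (q ^ (k + 2) * qfact q (q^2) (k + 2))
        = (1 + q + q ^ (2 * k + 3)) * (S (k + 1 + 1) * (q ^ (k + 1) * qfact q (q^2) (k + 1)))
        + (q ^ (2 * k + 2) - q) * (S (k + 1) * (q ^ k * qfact q (q^2) k))"
      by (simp add: algebra_simps)
    have i: "2 * (k + 2) - 1 = 2 * k + 3" "2 * (k + 2) - 2 = 2 * k + 2" "k + 2 - 1 = k + 1" "k + 2 - 2 = k"
      by auto
    have rec1: "P (k + 2) = (1 + q + q ^ (2 * k + 3)) * P (k + 1) + (q ^ (2 * k + 2) - q) * P k"
      using P(3)[rule_format, of "k + 2"] unfolding i by simp
    have rec2: "Q (k + 2) = (1 + q + q ^ (2 * k + 3)) * Q (k + 1) + (q ^ (2 * k + 2) - q) * Q k"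
      using Q(3)[rule_format, of "k + 2"] unfolding i by simp
    show "X * P (k + 2) - Y * Q (k + 2)
        = (1 + q + q ^ (2 * k + 3)) * (X * P (k + 1) - Y * Q (k + 1))
        + (q ^ (2 * k + 2) - q) * (X * P k - Y * Q k)"
      unfolding rec1 rec2 by (simp add: algebra_simps)
  qed
  \<comment> \<open>The leading coefficient 1 - q^(2k+3) of \<open>rec_T\<close> has no factor q, so
    (q;q^2)_k alone is the multiplier.\<close>
  have T_closed: "T k * qfact q (q^2) k = Y * A k - X * B k" for k
  proof (rule three_term_recurrence_unique)
    show "T 0 * qfact q (q^2) 0 = Y * A 0 - X * B 0"
      using T0 A B by simp
    have "T 1 * (1 - q) = Y - X * (2 * q)"
      using rec_S'[of 0] S1 T0 by (simp add: algebra_simps)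
    thus "T 1 * qfact q (q^2) 1 = Y * A 1 - X * B 1"
      using A(2) B(2) by (simp add: qfact_Suc)
    fix k
    have "T (k + 2) * qfact q (q^2) (k + 2)
        = ((1 - q ^ (2 * k + 3)) * T (k + 2)) * qfact q (q^2) (k + 1)"
      using qf[of "k + 1"] by (simp add: mult_ac power_add power3_eq_cube)
    also have "\<dots> = (1 + q + q ^ (2 * k + 2)) * (T (k + 1) * qfact q (q^2) (k + 1))
        - q * (T k * qfact q (q^2) (k + 1))"
      unfolding rec_T by (simp add: algebra_simps)
    also have "T k * qfact q (q^2) (k + 1) = (1 - q ^ (2 * k + 1)) * (T k * qfact q (q^2) k)"
      using qf[of k] by (simp add: mult_ac)
    finally show "T (k + 2) * qfact q (q^2) (k + 2)
        = (1 + q + q ^ (2 * k + 2)) * (T (k + 1) * qfact q (q^2) (k + 1))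
        + (q ^ (2 * k + 2) - q) * (T k * qfact q (q^2) k)"
      by (simp add: algebra_simps)
    have i: "2 * (k + 2) - 2 = 2 * k + 2" "k + 2 - 1 = k + 1" "k + 2 - 2 = k"
      by auto
    have rec1: "A (k + 2) = (1 + q + q ^ (2 * k + 2)) * A (k + 1) + (q ^ (2 * k + 2) - q) * A k"
      using A(3)[rule_format, of "k + 2"] unfolding i by simp
    have rec2: "B (k + 2) = (1 + q + q ^ (2 * k + 2)) * B (k + 1) + (q ^ (2 * k + 2) - q) * B k"
      using B(3)[rule_format, of "k + 2"] unfolding i by simp
    show "Y * A (k + 2) - X * B (k + 2)
        = (1 + q + q ^ (2 * k + 2)) * (Y * A (k + 1) - X * B (k + 1))
        + (q ^ (2 * k + 2) - q) * (Y * A k - X * B k)"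
      unfolding rec1 rec2 by (simp add: algebra_simps)
  qed
  show ?thesis
  proof (intro conjI allI impI)
    fix m :: nat assume "m \<ge> 1"
    then obtain k where m: "m = k + 1" by (metis le_add_diff_inverse2)
    have "q powi (1 - int m) = inverse (q ^ k)"
      by (simp add: m power_int_minus)
    moreover have "S m = (X * P k - Y * Q k) / (q ^ k * qfact q (q^2) k)"
      using S_closed[of k] q0 qfnz[of k] by (simp add: m eq_divide_eq)
    moreover have "s m sums S m"
      unfolding S_def by (intro summable_sums sum_s)
    ultimately show "(\<lambda>n. qfact (-q) (q^2) n * q ^ (n^2 + 2*m*n) / qfact q q (2*n + 1)) sums
        (q powi (1 - int m) * qfacts_inf [q^2, q^10, q^12] (q^12)
            / (qfact q (q^2) (m - 1) * qfact_inf q q) * P (m - 1)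
         - q powi (1 - int m) * qfacts_inf [-(q^2), -(q^4), q^6] (q^6) * qfact_inf (-q) (q^2)
            / (qfact q (q^2) (m - 1) * qfact_inf (q^2) (q^2)) * Q (m - 1))"
      by (simp add: m s_def a_def X_def Y_def diff_divide_distrib divide_inverse mult_ac right_diff_distrib
          del: mult_Suc_right power_Suc)
  next
    fix m
    have "T m = (Y * A m - X * B m) / qfact q (q^2) m"
      using T_closed[of m] qfnz[of m] by (simp add: eq_divide_eq)
    moreover have "t m sums T m"
      unfolding T_def by (intro summable_sums sum_t)
    ultimately show "(\<lambda>n. qfact (-q) (q^2) n * q ^ (n^2 + 2*m*n) / qfact q q (2*n)) sums
        (qfacts_inf [-(q^2), -(q^4), q^6] (q^6) * qfact_inf (-q) (q^2)
            / (qfact q (q^2) m * qfact_inf (q^2) (q^2)) * A m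
         - qfacts_inf [q^2, q^10, q^12] (q^12)
            / (qfact q (q^2) m * qfact_inf q q) * B m)"
      by (simp add: t_def a_def X_def Y_def diff_divide_distrib divide_inverse mult_ac right_diff_distrib)
  qed
qed

end
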